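(* Assume that $\gamma\|A\|^2<1$ and $\gamma\|A+\bar A\|^2<1$, that $Q,\bar Q,R,\bar R$ are symmetric, and that $Q\succeq 0$, $\tilde Q=Q+\bar Q\succeq 0$, $R\succ 0$, $\tilde R=R+\bar R\succ 0$. Then there exists a unique optimal control for the problem $\inf_{\mathbf u\in\mathcal U_{ad}}J(\mathbf u)$, i.e. a unique (up to almost sure equality at every time) $\mathbf u\in\mathcal U_{ad}$ with $J(\mathbf u)=\inf_{\mathbf u'\in\mathcal U_{ad}}J(\mathbf u')$. Moreover the optimal control $\mathbf u=(u_t)_{t\ge0}$ is in feedback form and linear in $(X^{\mathbf u},\bar X^{\mathbf u})$: there exist matrices $P,\bar P\in\mathbb R^{d\times d}$ satisfying the two matrix Riccati equations $$P=\gamma\big(A^\top P+2Q\big)\big(A-\tfrac12 BR^{-1}B^\top P\big),\qquad \bar P=\gamma\big(\tilde A^\top\bar P+2\tilde Q\big)\big(\tilde A-\tfrac12\tilde B\tilde R^{-1}\tilde B^\top\bar P\big)$$ such that, for every $t\ge 0$, $$u_t=-K^*(X^{\mathbf u}_t-\bar X^{\mathbf u}_t)-L^*\bar X^{\mathbf u}_t,$$ where $K^*=-\Gamma P$, $L^*=-\Lambda\bar P$, $\Gamma=-\tfrac12R^{-1}B^\top$ and $\Lambda=-\tfrac12\tilde R^{-1}\tilde B^\top$.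
   Context: Let $\gamma\in(0,1)$, $A,\bar A,Q,\bar Q\in\mathbb R^{d\times d}$, $B,\bar B\in\mathbb R^{d\times\ell}$, $R,\bar R\in\mathbb R^{\ell\times\ell}$; write $\tilde A=A+\bar A$, $\tilde B=B+\bar B$, $\tilde Q=Q+\bar Q$, $\tilde R=R+\bar R$. $\|\cdot\|$ is the Euclidean norm of vectors and the spectral norm of matrices; $\succeq0$ (resp. $\succ0$) means positive semi-definite (resp. definite). On a probability space there are $\mathbb R^d$-valued random vectors: initial perturbations $\varepsilon_0$ (idiosyncratic) and $\varepsilon^0_0$ (common), and noise sequences $(\varepsilon_{t+1})_{t\ge0}$ (idiosyncratic) and $(\varepsilon^0_{t+1})_{t\ge0}$ (common). Each noise sequence is i.i.d. with mean zero, the two noise sequences are independent of each other, $\varepsilon_0$ and $\varepsilon_0^0$ are independent of each other and of both noise sequences (and not assumed centered), and all these vectors are sub-gaussian. Set $\mathcal F^0_t=\sigma(\varepsilon^0_0,\dots,\varepsilon^0_t)$ and $\mathcal F_t=\sigma(\varepsilon_0,\varepsilon^0_0,\dots,\varepsilon_t,\varepsilon^0_t)$. For a process $(\xi_t)$, $\bar\xi_t:=\mathbb E[\xi_t\mid\mathcal F^0_t]$. $\mathcal U_{ad}$ is the set of $\mathbb R^\ell$-valued $(\mathcal F_t)$-adapted processes $(u_t)_{t\ge0}$ with $\mathbb E[\sum_{t\ge0}\gamma^t\|u_t\|^2]<\infty$. The state controlled by $\mathbf u$ is $X^{\mathbf u}_0=\varepsilon^0_0+\varepsilon_0$, $X^{\mathbf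 u}_{t+1}=AX^{\mathbf u}_t+\bar A\bar X^{\mathbf u}_t+Bu_t+\bar B\bar u_t+\varepsilon^0_{t+1}+\varepsilon_{t+1}$. The cost is $J(\mathbf u)=\mathbb E\big[\sum_{t\ge0}\gamma^tc(X^{\mathbf u}_t,\bar X^{\mathbf u}_t,u_t,\bar u_t)\big]$ with $c(x,\bar x,u,\bar u)=(x-\bar x)^\top Q(x-\bar x)+\bar x^\top\tilde Q\bar x+(u-\bar u)^\top R(u-\bar u)+\bar u^\top\tilde R\bar u$. *)

theory Defs
  imports "HOL-Analysis.Analysis" "HOL-Probability.Probability"
begin

text \<open>The instance \<open>norm\<close> on \<open>real ^ 'n ^ 'm\<close> is the Frobenius norm, so the spectral norm is
  expressed as an operator norm.\<close>

definition spectral_norm :: "real ^ 'n ^ 'm \<Rightarrow> real" where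
  "spectral_norm A = onorm (\<lambda>x. A *v x)"

definition symmetric_mat :: "real ^ 'n ^ 'n \<Rightarrow> bool" where
  "symmetric_mat A \<longleftrightarrow> transpose A = A"

definition quad :: "real ^ 'n ^ 'n \<Rightarrow> real ^ 'n \<Rightarrow> real" where
  "quad A x = x \<bullet> (A *v x)"

definition pos_semidef :: "real ^ 'n ^ 'n \<Rightarrow> bool" where
  "pos_semidef A \<longleftrightarrow> (\<forall>x. 0 \<le> quad A x)"

definition pos_def :: "real ^ 'n ^ 'n \<Rightarrow> bool" where
  "pos_def A \<longleftrightarrow> (\<forall>x. x \<noteq> 0 \<longrightarrow> 0 < quad A x)"

text \<open>A real variable is sub-gaussian iff its Orlicz \<open>\<psi>\<^sub>2\<close>-norm is finite (no centering is
  involved); a random vector is sub-gaussian iff all its one-dimensional marginals are.\<close>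

definition subgaussian :: "'a measure \<Rightarrow> ('a \<Rightarrow> real) \<Rightarrow> bool" where
  "subgaussian M X \<longleftrightarrow> X \<in> borel_measurable M \<and>
     (\<exists>s>0. (\<integral>\<^sup>+ \<omega>. ennreal (exp ((X \<omega> / s)\<^sup>2)) \<partial>M) \<le> 2)"

definition subgaussian_vec :: "'a measure \<Rightarrow> ('a \<Rightarrow> real ^ 'n) \<Rightarrow> bool" where
  "subgaussian_vec M X \<longleftrightarrow> X \<in> borel_measurable M \<and> (\<forall>v. subgaussian M (\<lambda>\<omega>. v \<bullet> X \<omega>))"

definition generated_sigma ::
    "'a measure \<Rightarrow> ('a \<Rightarrow> 'b::topological_space) set \<Rightarrow> 'a measure" where
  "generated_sigma M XS = sigma (space M) (\<Union>X\<in>XS. {X -` S \<inter> space M | S. S \<in> sets borel})"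

definition common_filtration ::
    "'a measure \<Rightarrow> (nat \<Rightarrow> 'a \<Rightarrow> real ^ 'd) \<Rightarrow> nat \<Rightarrow> 'a measure" where
  "common_filtration M eps0 t = generated_sigma M (eps0 ` {..t})"

definition full_filtration ::
    "'a measure \<Rightarrow> (nat \<Rightarrow> 'a \<Rightarrow> real ^ 'd) \<Rightarrow> (nat \<Rightarrow> 'a \<Rightarrow> real ^ 'd) \<Rightarrow> nat \<Rightarrow> 'a measure" where
  "full_filtration M eps eps0 t = generated_sigma M (eps ` {..t} \<union> eps0 ` {..t})"

definition vec_cond_exp ::
    "'a measure \<Rightarrow> 'a measure \<Rightarrow> ('a \<Rightarrow> real ^ 'n) \<Rightarrow> 'a \<Rightarrow> real ^ 'n" where
  "vec_cond_exp M F X \<omega> = (\<chi> i. real_cond_exp M F (\<lambda>\<omega>'. X \<omega>' $ i) \<omega>)"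

definition cond_mean ::
    "'a measure \<Rightarrow> (nat \<Rightarrow> 'a \<Rightarrow> real ^ 'd) \<Rightarrow> (nat \<Rightarrow> 'a \<Rightarrow> real ^ 'n) \<Rightarrow> nat \<Rightarrow> 'a \<Rightarrow> real ^ 'n" where
  "cond_mean M eps0 X t = vec_cond_exp M (common_filtration M eps0 t) (X t)"

text \<open>Throughout, \<open>eps 0\<close> and \<open>eps0 0\<close> are the idiosyncratic and common initial perturbations, and
  \<open>eps (Suc t)\<close>, \<open>eps0 (Suc t)\<close> the idiosyncratic and common noises.\<close>

definition admissible ::
    "'a measure \<Rightarrow> real \<Rightarrow> (nat \<Rightarrow> 'a \<Rightarrow> real ^ 'd) \<Rightarrow> (nat \<Rightarrow> 'a \<Rightarrow> real ^ 'd)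
      \<Rightarrow> (nat \<Rightarrow> 'a \<Rightarrow> real ^ 'l) set" where
  "admissible M \<gamma> eps eps0 =
     {u. (\<forall>t. u t \<in> borel_measurable (full_filtration M eps eps0 t)) \<and>
         (\<integral>\<^sup>+ \<omega>. (\<Sum>t. ennreal (\<gamma> ^ t * (norm (u t \<omega>))\<^sup>2)) \<partial>M) < \<infinity>}"

primrec state ::
    "'a measure \<Rightarrow> real ^ 'd ^ 'd \<Rightarrow> real ^ 'd ^ 'd \<Rightarrow> real ^ 'l ^ 'd \<Rightarrow> real ^ 'l ^ 'd
      \<Rightarrow> (nat \<Rightarrow> 'a \<Rightarrow> real ^ 'd) \<Rightarrow> (nat \<Rightarrow> 'a \<Rightarrow> real ^ 'd)
      \<Rightarrow> (nat \<Rightarrow> 'a \<Rightarrow> real ^ 'l) \<Rightarrow> nat \<Rightarrow> 'a \<Rightarrow> real ^ 'd" where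
  "state M A Abar B Bbar eps eps0 u 0 = (\<lambda>\<omega>. eps0 0 \<omega> + eps 0 \<omega>)"
| "state M A Abar B Bbar eps eps0 u (Suc t) = (\<lambda>\<omega>.
     A *v state M A Abar B Bbar eps eps0 u t \<omega>
     + Abar *v vec_cond_exp M (common_filtration M eps0 t)
                 (state M A Abar B Bbar eps eps0 u t) \<omega>
     + B *v u t \<omega> + Bbar *v cond_mean M eps0 u t \<omega>
     + eps0 (Suc t) \<omega> + eps (Suc t) \<omega>)"

definition running_cost ::
    "real ^ 'd ^ 'd \<Rightarrow> real ^ 'd ^ 'd \<Rightarrow> real ^ 'l ^ 'l \<Rightarrow> real ^ 'l ^ 'l
      \<Rightarrow> real ^ 'd \<Rightarrow> real ^ 'd \<Rightarrow> real ^ 'l \<Rightarrow> real ^ 'l \<Rightarrow> real" where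
  "running_cost Q Qbar R Rbar x xbar v vbar =
     quad Q (x - xbar) + quad (Q + Qbar) xbar + quad R (v - vbar) + quad (R + Rbar) vbar"

text \<open>Taking values in \<open>ennreal\<close> avoids junk values of non-convergent sums and integrals. The
  coercion \<open>ennreal\<close> truncates negative reals, which is harmless here because the running cost is
  nonnegative whenever \<open>Q\<close>, \<open>Q + Qbar\<close>, \<open>R\<close> and \<open>R + Rbar\<close> are positive semi-definite.\<close>

definition cost ::
    "'a measure \<Rightarrow> real \<Rightarrow> real ^ 'd ^ 'd \<Rightarrow> real ^ 'd ^ 'd \<Rightarrow> real ^ 'l ^ 'd \<Rightarrow> real ^ 'l ^ 'd
      \<Rightarrow> real ^ 'd ^ 'd \<Rightarrow> real ^ 'd ^ 'd \<Rightarrow> real ^ 'l ^ 'l \<Rightarrow> real ^ 'l ^ 'l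
      \<Rightarrow> (nat \<Rightarrow> 'a \<Rightarrow> real ^ 'd) \<Rightarrow> (nat \<Rightarrow> 'a \<Rightarrow> real ^ 'd)
      \<Rightarrow> (nat \<Rightarrow> 'a \<Rightarrow> real ^ 'l) \<Rightarrow> ennreal" where
  "cost M \<gamma> A Abar B Bbar Q Qbar R Rbar eps eps0 u =
     (let X = state M A Abar B Bbar eps eps0 u in
      \<integral>\<^sup>+ \<omega>. (\<Sum>t. ennreal (\<gamma> ^ t *
        running_cost Q Qbar R Rbar (X t \<omega>) (cond_mean M eps0 X t \<omega>)
          (u t \<omega>) (cond_mean M eps0 u t \<omega>))) \<partial>M)"

definition optimal_control ::
    "'a measure \<Rightarrow> real \<Rightarrow> real ^ 'd ^ 'd \<Rightarrow> real ^ 'd ^ 'd \<Rightarrow> real ^ 'l ^ 'd \<Rightarrow> real ^ 'l ^ 'd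
      \<Rightarrow> real ^ 'd ^ 'd \<Rightarrow> real ^ 'd ^ 'd \<Rightarrow> real ^ 'l ^ 'l \<Rightarrow> real ^ 'l ^ 'l
      \<Rightarrow> (nat \<Rightarrow> 'a \<Rightarrow> real ^ 'd) \<Rightarrow> (nat \<Rightarrow> 'a \<Rightarrow> real ^ 'd)
      \<Rightarrow> (nat \<Rightarrow> 'a \<Rightarrow> real ^ 'l) \<Rightarrow> bool" where
  "optimal_control M \<gamma> A Abar B Bbar Q Qbar R Rbar eps eps0 u \<longleftrightarrow>
     u \<in> admissible M \<gamma> eps eps0 \<and>
     cost M \<gamma> A Abar B Bbar Q Qbar R Rbar eps eps0 u =
       (INF v \<in> admissible M \<gamma> eps eps0. cost M \<gamma> A Abar B Bbar Q Qbar R Rbar eps eps0 v)"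

definition riccati ::
    "real \<Rightarrow> real ^ 'd ^ 'd \<Rightarrow> real ^ 'l ^ 'd \<Rightarrow> real ^ 'd ^ 'd \<Rightarrow> real ^ 'l ^ 'l
      \<Rightarrow> real ^ 'd ^ 'd \<Rightarrow> bool" where
  "riccati \<gamma> A B Q R P \<longleftrightarrow>
     P = \<gamma> *\<^sub>R ((transpose A ** P + 2 *\<^sub>R Q) **
              (A - (1 / 2) *\<^sub>R (B ** matrix_inv R ** transpose B ** P)))"

definition gain :: "real ^ 'l ^ 'd \<Rightarrow> real ^ 'l ^ 'l \<Rightarrow> real ^ 'd ^ 'l" where
  "gain B R = - (1 / 2) *\<^sub>R (matrix_inv R ** transpose B)"

end

theory Submission
  imports Defs
begin

text \<open>The deviation \<open>X - Xbar\<close> and the conditional mean \<open>Xbar\<close> follow two separate linear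
  recursions, driven by \<open>u - ubar\<close> and \<open>ubar\<close> respectively and by noise that is uncorrelated with
  the past, and the running cost splits accordingly. For each of them value iteration (monotone, and
  bounded because \<open>\<gamma> \<parallel>A\<parallel>\<^sup>2 < 1\<close>) yields a symmetric fixed point \<open>S\<close> of the Bellman equation, and
  completing the square writes the cost as a constant plus the discounted sum of
  \<open>E[(v + K y)\<^sup>T (R + \<gamma> B\<^sup>T S B) (v + K y)]\<close>; the boundary term \<open>\<gamma>\<^sup>t E[y\<^sub>t\<^sup>T S y\<^sub>t]\<close> vanishes since
  \<open>\<gamma> \<parallel>A\<parallel>\<^sup>2 < 1\<close>. Hence a control is optimal iff it is the linear feedback. The matrix of the
  statement is \<open>P = 2 \<gamma> S (A - B K)\<close>, which maps the state to the adjoint variable and need not be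
  symmetric.\<close>

section \<open>Quadratic forms and the Riccati equation\<close>

text \<open>Two matrices appear for each system because completing the square works with the
  symmetric value matrix \<open>S\<close>, whereas the stated equation is solved by
  \<open>P\<close>. The link is stationarity of the gain, R K = \<gamma> B^T S (A - B K). Its
  right-hand side is half of B^T P, so K = (1/2) R^{-1} B^T P, the second factor of the Riccati
  equation is the closed-loop matrix A - B K, and the Bellman equation turns into A^T P + 2 Q = 2 S.
  The recursion for the conditional mean closes because the common noise at time t + 1 is
  independent of F_t: conditioning an F_t-measurable vector on F^0_{t+1} or on F^0_t gives the same
  result. The feedback law refers to the state driven by the very control it defines. Existence is
  therefore a construction: state and control are generated together, and admissibility is proved
  afterwards. For this purpose the cost identity is kept at finite horizon first, where square
  integrability at each time suffices; the passage to infinite horizon uses the discounted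
  summability that admissible controls have by definition.\<close>

lemma inner_matrix_vector_transpose:
  fixes A :: "real ^ 'n ^ 'm"
  shows "x \<bullet> (A *v y) = (transpose A *v x) \<bullet> y"
  by (simp add: dot_lmul_matrix)

(* transpose_matrix_vector would turn transpose A *v x into x v* A. *)
declare transpose_matrix_vector [simp del]

lemma matrix_vector_minus_left: "(- A) *v x = - (A *v (x :: real ^ 'n))"
  by (simp add: matrix_vector_mult_def vec_eq_iff sum_negf)

lemmas matrix_vector_distribs =
  matrix_vector_mul_assoc[symmetric] matrix_vector_right_distrib matrix_vector_mult_diff_distrib
  matrix_vector_mult_add_rdistrib matrix_vector_mult_diff_rdistrib
  matrix_vector_mult_scaleR scaleR_matrix_vector_assoc[symmetric] vec.neg
  matrix_vector_minus_left

lemma inner_symmetric_mat: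
  assumes "symmetric_mat S"
  shows "x \<bullet> (S *v y) = y \<bullet> (S *v x)"
  using assms by (metis inner_commute inner_matrix_vector_transpose symmetric_mat_def)

lemma quad_add:
  assumes "symmetric_mat S"
  shows "quad S (x + y) = quad S x + 2 * (x \<bullet> (S *v y)) + quad S y"
  unfolding quad_def using inner_symmetric_mat[OF assms, of y x]
  by (simp add: matrix_vector_right_distrib inner_add_left inner_add_right)

lemma quad_minus [simp]: "quad S (- x) = quad S x"
  by (simp add: quad_def vec.neg)

lemma quad_matrix_vector:
  fixes B :: "real ^ 'n ^ 'm"
  shows "quad S (B *v x) = quad (transpose B ** S ** B) x"
  unfolding quad_def
  by (simp add: matrix_vector_mul_assoc[symmetric] inner_matrix_vector_transpose[of x "transpose B"])

lemma quad_add_mat: "quad (S + T) x = quad S x + quad T x"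
  and quad_scaleR_mat: "quad (c *\<^sub>R S) x = c * quad S x"
  by (simp_all add: quad_def matrix_vector_mult_add_rdistrib inner_add_right scaleR_matrix_vector_assoc[symmetric])

lemma transpose_add: "transpose (S + T) = transpose S + transpose T"
  and transpose_diff: "transpose (S - T) = transpose S - transpose T"
  by (simp_all add: transpose_def vec_eq_iff)

lemma symmetric_mat_add: "symmetric_mat S \<Longrightarrow> symmetric_mat T \<Longrightarrow> symmetric_mat (S + T)"
  and symmetric_mat_scaleR: "symmetric_mat S \<Longrightarrow> symmetric_mat (c *\<^sub>R S)"
  by (simp_all add: symmetric_mat_def transpose_add transpose_scalar)

lemma symmetric_mat_congruence:
  fixes B :: "real ^ 'n ^ 'm"
  shows "symmetric_mat S \<Longrightarrow> symmetric_mat (transpose B ** S ** B)"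
  by (simp add: symmetric_mat_def matrix_transpose_mul matrix_mul_assoc)

lemma continuous_on_quad: "continuous_on U (quad S)"
  unfolding quad_def
  by (intro continuous_intros linear_continuous_on matrix_vector_mul_bounded_linear)

text \<open>Polarization. It lets equality and convergence of symmetric matrices be read off from
  their quadratic forms, which is where the monotonicity of value iteration lives.\<close>

lemma symmetric_mat_entry:
  assumes "symmetric_mat S"
  shows "S $ i $ j = (quad S (axis i 1 + axis j 1) - quad S (axis i 1) - quad S (axis j 1)) / 2"
proof -
  have "axis i 1 \<bullet> (S *v axis j 1) = S $ i $ j"
    by (simp add: inner_axis' matrix_vector_mult_basis column_def)
  thus ?thesis by (simp add: quad_add[OF assms])
qed

lemma symmetric_mat_eqI:
  assumes "symmetric_mat S" "symmetric_mat T" "\<And>x. quad S x = quad T x"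
  shows "S = T"
  by (simp add: vec_eq_iff symmetric_mat_entry[OF assms(1)] symmetric_mat_entry[OF assms(2)] assms(3))

lemma quad_upper_bound: "quad S x \<le> onorm ((*v) S) * (norm x)\<^sup>2"
proof -
  have "quad S x \<le> norm x * norm (S *v x)" unfolding quad_def by (rule norm_cauchy_schwarz)
  also have "\<dots> \<le> norm x * (onorm ((*v) S) * norm x)"
    by (intro mult_left_mono onorm matrix_vector_mul_bounded_linear) auto
  finally show ?thesis by (simp add: power2_eq_square mult_ac)
qed

lemma pos_defD: "pos_def R \<Longrightarrow> x \<noteq> 0 \<Longrightarrow> 0 < quad R x"
  by (simp add: pos_def_def)

text \<open>The form attains its minimum on the compact unit sphere, and homogeneity of degree two
  carries this minimum to all vectors.\<close>

lemma pos_def_coercive: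
  assumes "pos_def R"
  shows "\<exists>r>0. \<forall>x. r * (norm x)\<^sup>2 \<le> quad R x"
proof -
  obtain x0 where x0: "x0 \<in> sphere 0 1" "\<And>y. y \<in> sphere 0 1 \<Longrightarrow> quad R x0 \<le> quad R y"
    using continuous_attains_inf[OF compact_sphere _ continuous_on_quad, of 0 1 R] by auto
  have "quad R x0 * (norm x)\<^sup>2 \<le> quad R x" for x
  proof (cases "x = 0")
    case False
    have "quad R ((1 / norm x) *\<^sub>R x) = quad R x / (norm x)\<^sup>2"
      by (simp add: quad_def matrix_vector_mult_scaleR power2_eq_square)
    moreover have "quad R x0 \<le> quad R ((1 / norm x) *\<^sub>R x)" using False by (intro x0) simp
    ultimately show ?thesis using False by (simp add: pos_le_divide_eq)
  qed (simp add: quad_def)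
  moreover have "quad R x0 > 0" using x0(1) by (intro pos_defD[OF assms]) auto
  ultimately show ?thesis by blast
qed

lemma pos_def_matrix_inv:
  assumes "pos_def N"
  shows "N ** matrix_inv N = mat 1" "matrix_inv N ** N = mat 1"
proof -
  have "inj ((*v) N)"
  proof (rule injI)
    fix x y assume "N *v x = N *v y"
    hence "\<not> 0 < quad N (x - y)" by (simp add: quad_def matrix_vector_mult_diff_distrib)
    hence "\<not> x - y \<noteq> 0" by (rule contrapos_nn) (rule pos_defD[OF assms])
    thus "x = y" by simp
  qed
  hence "invertible N" unfolding invertible_left_inverse matrix_left_invertible_injective .
  \<comment> \<open>\<open>matrix_inv\<close> is a Hilbert choice, so its two equations follow once
    some two-sided inverse is known to exist.\<close>
  hence "\<exists>N'. N ** N' = mat 1 \<and> N' ** N = mat 1" unfolding invertible_def .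
  hence inv: "N ** matrix_inv N = mat 1 \<and> matrix_inv N ** N = mat 1"
    unfolding matrix_inv_def by (rule someI_ex)
  show "N ** matrix_inv N = mat 1" by (rule conjunct1[OF inv])
  show "matrix_inv N ** N = mat 1" by (rule conjunct2[OF inv])
qed

text \<open>For symmetric \<open>R\<close> and \<open>S\<close>, with \<open>R\<close> positive
  definite and \<open>S\<close> positive semi-definite, u = - K x is the minimiser of
  \<open>quad R u + \<gamma> * quad S (A *v x + B *v u)\<close>.\<close>

definition feedback_gain ::
    "real \<Rightarrow> real ^ 'd ^ 'd \<Rightarrow> real ^ 'l ^ 'd \<Rightarrow> real ^ 'l ^ 'l \<Rightarrow> real ^ 'd ^ 'd \<Rightarrow> real ^ 'd ^ 'l" where
  "feedback_gain \<gamma> A B R S =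
     matrix_inv (R + \<gamma> *\<^sub>R (transpose B ** S ** B)) ** (\<gamma> *\<^sub>R (transpose B ** S ** A))"

text \<open>The first-order condition of that minimisation at u = - K x, with the terms arranged so
  that no inverse occurs and the closed-loop matrix A - B K is visible.\<close>

definition stationary_gain ::
    "real \<Rightarrow> real ^ 'd ^ 'd \<Rightarrow> real ^ 'l ^ 'd \<Rightarrow> real ^ 'l ^ 'l \<Rightarrow> real ^ 'd ^ 'd \<Rightarrow> real ^ 'd ^ 'l \<Rightarrow> bool" where
  "stationary_gain \<gamma> A B R S K \<longleftrightarrow>
     R ** K = \<gamma> *\<^sub>R (transpose B ** S ** (A - B ** K))"

text \<open>The Joseph form of the Riccati operator keeps symmetry and positivity visible.\<close>

definition riccati_step ::
    "real \<Rightarrow> real ^ 'd ^ 'd \<Rightarrow> real ^ 'l ^ 'd \<Rightarrow> real ^ 'd ^ 'd \<Rightarrow> real ^ 'l ^ 'l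
      \<Rightarrow> real ^ 'd ^ 'd \<Rightarrow> real ^ 'd ^ 'd" where
  "riccati_step \<gamma> A B Q R S = (let K = feedback_gain \<gamma> A B R S in
     Q + transpose K ** R ** K + \<gamma> *\<^sub>R (transpose (A - B ** K) ** S ** (A - B ** K)))"

lemma pos_def_add_congruence:
  assumes "pos_def R" "pos_semidef S" "0 \<le> \<gamma>"
  shows "pos_def (R + \<gamma> *\<^sub>R (transpose B ** S ** B))"
  using assms unfolding pos_def_def pos_semidef_def quad_add_mat quad_scaleR_mat
    quad_matrix_vector[symmetric]
  by (auto intro!: add_pos_nonneg)

lemma stationary_feedback_gain:
  assumes "pos_def R" "pos_semidef S" "0 \<le> \<gamma>"
  shows "stationary_gain \<gamma> A B R S (feedback_gain \<gamma> A B R S)"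
proof -
  let ?K = "feedback_gain \<gamma> A B R S"
  have "(R + \<gamma> *\<^sub>R (transpose B ** S ** B)) ** ?K = \<gamma> *\<^sub>R (transpose B ** S ** A)"
    unfolding feedback_gain_def
    by (simp add: matrix_mul_assoc pos_def_matrix_inv(1)[OF pos_def_add_congruence[OF assms]])
  thus ?thesis unfolding stationary_gain_def matrix_eq
    by (simp add: matrix_vector_distribs scaleR_diff_right eq_diff_eq)
qed

text \<open>Write u = h - K x. The terms linear in h are - 2 h . (R K x) from the control cost and 2
  \<gamma> (B h) . S (A - B K) x from the next state; stationarity says exactly that they
  cancel.\<close>

lemma complete_square:
  assumes "symmetric_mat S" "symmetric_mat R" "stationary_gain \<gamma> A B R S K"
  shows "quad R u + \<gamma> * quad S (A *v x + B *v u)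
       = quad R (K *v x) + \<gamma> * quad S ((A - B ** K) *v x)
         + quad (R + \<gamma> *\<^sub>R (transpose B ** S ** B)) (u + K *v x)"
proof -
  define h where "h = u + K *v x"
  let ?c = "(A - B ** K) *v x"
  have u: "u = h + - (K *v x)" by (simp add: h_def)
  have s: "A *v x + B *v u = B *v h + ?c"
    by (simp add: u matrix_vector_distribs)
  have "(B *v h) \<bullet> (S *v ?c) = h \<bullet> ((transpose B ** S ** (A - B ** K)) *v x)"
    by (simp add: matrix_vector_mul_assoc[symmetric] inner_matrix_vector_transpose[of h "transpose B"])
  hence "\<gamma> * ((B *v h) \<bullet> (S *v ?c)) = h \<bullet> ((\<gamma> *\<^sub>R (transpose B ** S ** (A - B ** K))) *v x)"
    by (simp add: scaleR_matrix_vector_assoc[symmetric])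
  also have "\<dots> = h \<bullet> (R *v (K *v x))"
    unfolding assms(3)[unfolded stationary_gain_def, symmetric] by (simp add: matrix_vector_mul_assoc)
  finally have cross: "\<gamma> * ((B *v h) \<bullet> (S *v ?c)) = h \<bullet> (R *v (K *v x))" .
  have "quad R u = quad R h - 2 * (h \<bullet> (R *v (K *v x))) + quad R (K *v x)"
    unfolding u by (subst quad_add[OF assms(2)]) (simp add: vec.neg)
  moreover have "\<gamma> * quad S (A *v x + B *v u)
      = \<gamma> * quad S (B *v h) + 2 * (\<gamma> * ((B *v h) \<bullet> (S *v ?c))) + \<gamma> * quad S ?c"
    unfolding s quad_add[OF assms(1)] by (simp add: distrib_left)
  ultimately show ?thesis
    unfolding h_def[symmetric] cross quad_add_mat quad_scaleR_mat quad_matrix_vector[symmetric]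
    by linarith
qed

lemma quad_riccati_step:
  "quad (riccati_step \<gamma> A B Q R S) x = (let K = feedback_gain \<gamma> A B R S in
     quad Q x + quad R (K *v x) + \<gamma> * quad S ((A - B ** K) *v x))"
  by (simp add: riccati_step_def Let_def quad_add_mat quad_scaleR_mat quad_matrix_vector[symmetric])

lemma symmetric_riccati_step:
  assumes "symmetric_mat Q" "symmetric_mat R" "symmetric_mat S"
  shows "symmetric_mat (riccati_step \<gamma> A B Q R S)"
  unfolding riccati_step_def Let_def
  by (intro symmetric_mat_add symmetric_mat_scaleR symmetric_mat_congruence assms)

lemma pos_def_imp_semidef: "pos_def R \<Longrightarrow> pos_semidef R"
  unfolding pos_def_def pos_semidef_def
  by (metis inner_zero_left less_eq_real_def quad_def)

lemma pos_semidef_riccati_step: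
  assumes "pos_semidef Q" "pos_def R" "pos_semidef S" "0 \<le> \<gamma>"
  shows "pos_semidef (riccati_step \<gamma> A B Q R S)"
  using assms pos_def_imp_semidef[of R]
  by (auto simp: pos_semidef_def quad_riccati_step Let_def)

text \<open>The remainder of the completed square is nonnegative. Since the left-hand side is the
  value at u = - K x, the step is the Bellman operator: a minimum over all \<open>u\<close>, into
  which any convenient \<open>u\<close> may be inserted.\<close>

lemma quad_riccati_step_le:
  assumes "symmetric_mat R" "symmetric_mat S" "pos_def R" "pos_semidef S" "0 \<le> \<gamma>"
  shows "quad (riccati_step \<gamma> A B Q R S) x \<le> quad Q x + quad R u + \<gamma> * quad S (A *v x + B *v u)"
proof -
  let ?K = "feedback_gain \<gamma> A B R S"
  have "quad (R + \<gamma> *\<^sub>R (transpose B ** S ** B)) (u + ?K *v x) \<ge> 0"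
    using pos_def_imp_semidef[OF pos_def_add_congruence[OF assms(3-5)]] by (auto simp: pos_semidef_def)
  thus ?thesis
    using complete_square[OF assms(2,1) stationary_feedback_gain[OF assms(3-5)], where u=u and x=x and A=A and B=B]
    by (simp add: quad_riccati_step Let_def)
qed

section \<open>Continuity of the gain and convergence of value iteration\<close>

lemma tendsto_matrix_vector_mult:
  fixes F :: "'i \<Rightarrow> real ^ 'n ^ 'm"
  assumes "(F \<longlongrightarrow> S) net" "(g \<longlongrightarrow> x) net"
  shows "((\<lambda>i. F i *v g i) \<longlongrightarrow> S *v x) net"
  by (rule vec_tendstoI) (auto simp: matrix_vector_mult_def intro!: tendsto_intros assms)

lemma tendsto_quad:
  assumes "(F \<longlongrightarrow> S) net" "(g \<longlongrightarrow> x) net"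
  shows "((\<lambda>i. quad (F i) (g i)) \<longlongrightarrow> quad S x) net"
  unfolding quad_def by (intro tendsto_intros tendsto_matrix_vector_mult assms)

lemma tendsto_matrix_matrix_mult:
  fixes F :: "'i \<Rightarrow> real ^ 'n ^ 'm" and G :: "'i \<Rightarrow> real ^ 'k ^ 'n"
  assumes "(F \<longlongrightarrow> S) net" "(G \<longlongrightarrow> T) net"
  shows "((\<lambda>i. F i ** G i) \<longlongrightarrow> S ** T) net"
  by (intro vec_tendstoI) (auto simp: matrix_matrix_mult_def intro!: tendsto_intros assms)

text \<open>The gain solves a linear system whose matrix R + \<gamma> B^T S B dominates
  \<open>R\<close>, hence is coercive with the same constant r for every \<open>F n\<close>. The
  error of the n-th gain is thus at most 1 / r times the residual of the limiting gain in the n-th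
  system. The residual involves only sums and products of matrices, so it tends to the residual in
  the limiting system, which is 0.\<close>

lemma tendsto_feedback_gain:
  assumes R: "pos_def R" and S: "\<And>n. pos_semidef (F n)" "pos_semidef S" and \<gamma>: "0 \<le> \<gamma>"
    and lim: "F \<longlonglongrightarrow> S"
  shows "(\<lambda>n. feedback_gain \<gamma> A B R (F n) *v x) \<longlonglongrightarrow> feedback_gain \<gamma> A B R S *v x"
proof -
  obtain r where r: "r > 0" "\<And>x. r * (norm x)\<^sup>2 \<le> quad R x" using pos_def_coercive[OF R] by auto
  let ?N = "\<lambda>S. R + \<gamma> *\<^sub>R (transpose B ** S ** B)"
  let ?K = "feedback_gain \<gamma> A B R"
  let ?G = "\<lambda>S. \<gamma> *\<^sub>R (transpose B ** S ** A) *v x"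
  have NK: "?N S *v (?K S *v x) = ?G S" if "pos_semidef S" for S
    unfolding feedback_gain_def
    by (simp add: matrix_vector_mul_assoc matrix_mul_assoc
        pos_def_matrix_inv(1)[OF pos_def_add_congruence[OF R that \<gamma>]])
  have bound: "norm (?K (F n) *v x - ?K S *v x) \<le> norm (?G (F n) - ?N (F n) *v (?K S *v x)) / r" for n
  proof -
    let ?w = "?K (F n) *v x - ?K S *v x"
    have "r * (norm ?w)\<^sup>2 \<le> quad R ?w" by (rule r)
    also have "\<dots> \<le> quad (?N (F n)) ?w"
      using S(1)[of n] \<gamma> by (simp add: quad_add_mat quad_scaleR_mat quad_matrix_vector[symmetric] pos_semidef_def)
    also have "\<dots> \<le> norm ?w * norm (?N (F n) *v ?w)" unfolding quad_def by (rule norm_cauchy_schwarz)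
    also have "?N (F n) *v ?w = ?G (F n) - ?N (F n) *v (?K S *v x)"
      using NK[OF S(1)[of n]] by (simp add: matrix_vector_mult_diff_distrib)
    finally have "norm ?w * (r * norm ?w) \<le> norm ?w * norm (?G (F n) - ?N (F n) *v (?K S *v x))"
      by (simp add: power2_eq_square mult_ac)
    hence "r * norm ?w \<le> norm (?G (F n) - ?N (F n) *v (?K S *v x))"
      by (cases "norm ?w = 0") (auto dest: mult_left_le_imp_le)
    thus ?thesis using r by (simp add: field_simps)
  qed
  have "(\<lambda>n. norm (?G (F n) - ?N (F n) *v (?K S *v x)) / r)
      \<longlonglongrightarrow> norm (?G S - ?N S *v (?K S *v x)) / r"
    by (intro tendsto_intros tendsto_matrix_vector_mult tendsto_matrix_matrix_mult lim) (use r in auto)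
  hence "(\<lambda>n. norm (?G (F n) - ?N (F n) *v (?K S *v x)) / r) \<longlonglongrightarrow> 0"
    using NK[OF S(2)] by simp
  hence "(\<lambda>n. ?K (F n) *v x - ?K S *v x) \<longlonglongrightarrow> 0"
    by (rule tendsto_0_le[where K=1]) (use bound in \<open>auto simp: r(1) less_imp_le\<close>)
  thus ?thesis by (simp add: LIM_zero_iff)
qed

lemma riccati_fixed_point:
  fixes A Q :: "real ^ 'd ^ 'd" and B :: "real ^ 'l ^ 'd"
  assumes \<gamma>: "0 < \<gamma>" and A: "\<gamma> * (spectral_norm A)\<^sup>2 < 1"
    and Q: "symmetric_mat Q" "pos_semidef Q" and R: "symmetric_mat R" "pos_def R"
  shows "\<exists>S. symmetric_mat S \<and> pos_semidef S \<and> riccati_step \<gamma> A B Q R S = S"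
proof -
  \<comment> \<open>\<open>F n\<close> is the value matrix of the problem with n stages and zero
    terminal cost.\<close>
  define F where "F n = (riccati_step \<gamma> A B Q R ^^ n) 0" for n
  have F_Suc: "F (Suc n) = riccati_step \<gamma> A B Q R (F n)" for n by (simp add: F_def)
  have sym: "symmetric_mat (F n)" for n
    by (induction n) (auto simp: F_Suc intro!: symmetric_riccati_step Q R,
        simp add: F_def symmetric_mat_def transpose_def vec_eq_iff)
  have psd: "pos_semidef (F n)" for n
    by (induction n) (use \<gamma> in \<open>auto simp: F_Suc intro!: pos_semidef_riccati_step Q R\<close>,
        simp add: F_def pos_semidef_def quad_def)
  have step_le: "quad (F (Suc n)) x \<le> quad Q x + quad R u + \<gamma> * quad (F n) (A *v x + B *v u)" for n x u
    unfolding F_Suc using quad_riccati_step_le[OF R(1) sym R(2) psd] \<gamma> by simp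
  have mono: "quad (F n) x \<le> quad (F (Suc n)) x" for n x
  proof (induction n arbitrary: x)
    case 0
    show ?case using psd[of 1] by (simp add: F_def pos_semidef_def quad_def[of 0])
  next
    case (Suc n)
    \<comment> \<open>The gain that is optimal for \<open>F (Suc n)\<close> is merely a candidate
      for \<open>F n\<close>. Used in both stages, it leaves only the two terminal values to
      compare, which is the induction hypothesis.\<close>
    let ?K = "feedback_gain \<gamma> A B R (F (Suc n))"
    have "quad (F (Suc n)) x \<le> quad Q x + quad R (- (?K *v x)) + \<gamma> * quad (F n) (A *v x + B *v (- (?K *v x)))"
      by (rule step_le)
    also have "A *v x + B *v (- (?K *v x)) = (A - B ** ?K) *v x"
      by (simp add: matrix_vector_distribs)
    also have "quad (F n) ((A - B ** ?K) *v x) \<le> quad (F (Suc n)) ((A - B ** ?K) *v x)" by (rule Suc)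
    finally show ?case using \<gamma> by (simp add: F_Suc[of "Suc n"] quad_riccati_step Let_def)
  qed
  \<comment> \<open>The solution of c = |Q| + \<gamma> |A|^2 c, the recursion for the growth
    constant of the uncontrolled cost; it is finite and nonnegative because \<gamma> |A|^2 <
    1.\<close>
  define c where "c = onorm ((*v) Q) / (1 - \<gamma> * (spectral_norm A)\<^sup>2)"
  have c: "onorm ((*v) Q) + \<gamma> * (spectral_norm A)\<^sup>2 * c = c" "0 \<le> c"
    using A onorm_pos_le[OF matrix_vector_mul_bounded_linear, of Q] by (auto simp: c_def field_simps)
  have bound: "quad (F n) x \<le> c * (norm x)\<^sup>2" for n x
  proof (induction n arbitrary: x)
    case 0
    show ?case using c(2) by (simp add: F_def quad_def)
  next
    case (Suc n)
    have "norm (A *v x) \<le> spectral_norm A * norm x"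
      unfolding spectral_norm_def by (rule onorm[OF matrix_vector_mul_bounded_linear])
    hence n: "(norm (A *v x))\<^sup>2 \<le> (spectral_norm A)\<^sup>2 * (norm x)\<^sup>2"
      by (metis norm_ge_zero power_mono power_mult_distrib)
    \<comment> \<open>The candidate control is u = 0.\<close>
    have "quad (F (Suc n)) x \<le> quad Q x + \<gamma> * quad (F n) (A *v x)"
      using step_le[of n x 0] by (simp add: quad_def[of R])
    also have "\<dots> \<le> onorm ((*v) Q) * (norm x)\<^sup>2 + \<gamma> * (c * (norm (A *v x))\<^sup>2)"
      using \<gamma> by (intro add_mono quad_upper_bound mult_left_mono Suc) auto
    also have "\<dots> \<le> onorm ((*v) Q) * (norm x)\<^sup>2 + \<gamma> * (c * ((spectral_norm A)\<^sup>2 * (norm x)\<^sup>2))"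
      using \<gamma> c(2) n by (intro add_left_mono mult_left_mono) auto
    also have "\<dots> = (onorm ((*v) Q) + \<gamma> * (spectral_norm A)\<^sup>2 * c) * (norm x)\<^sup>2" by (simp add: algebra_simps)
    finally show ?case by (simp add: c(1))
  qed
  have "\<exists>q. (\<lambda>n. quad (F n) x) \<longlonglongrightarrow> q" for x
  proof -
    have "incseq (\<lambda>n. quad (F n) x)" using mono by (intro incseq_SucI)
    thus ?thesis using bound by (meson incseq_convergent)
  qed
  then obtain q where q: "\<And>x. (\<lambda>n. quad (F n) x) \<longlonglongrightarrow> q x" by metis
  \<comment> \<open>Polarization turns pointwise convergence of the forms into convergence of every
    matrix entry.\<close>
  define L where "L i j = (q (axis i 1 + axis j 1) - q (axis i 1) - q (axis j 1)) / 2" for i j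
  have L: "(\<lambda>n. F n $ i $ j) \<longlonglongrightarrow> L i j" for i j
    unfolding symmetric_mat_entry[OF sym] L_def by (intro tendsto_intros q) simp
  define S :: "real ^ 'd ^ 'd" where "S = (\<chi> i j. L i j)"
  have lim: "F \<longlonglongrightarrow> S" unfolding S_def by (intro vec_tendstoI) (simp add: L)
  have qlim: "(\<lambda>n. quad (F n) x) \<longlonglongrightarrow> quad S x" for x by (intro tendsto_quad lim tendsto_const)
  have symS: "symmetric_mat S"
    by (simp add: S_def L_def symmetric_mat_def transpose_def vec_eq_iff add.commute)
  have psdS: "pos_semidef S" unfolding pos_semidef_def
    using qlim psd by (intro allI LIMSEQ_le_const[OF qlim]) (auto simp: pos_semidef_def)
  \<comment> \<open>The forms of \<open>F (Suc n)\<close> have two limits: one by continuity of the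
    step along \<open>F\<close>, the other as a shift of the convergent sequence itself.\<close>
  have "quad (riccati_step \<gamma> A B Q R S) x = quad S x" for x
  proof (rule LIMSEQ_unique)
    let ?K = "feedback_gain \<gamma> A B R"
    have K: "(\<lambda>n. ?K (F n) *v x) \<longlonglongrightarrow> ?K S *v x"
      using \<gamma> by (intro tendsto_feedback_gain R psd psdS lim) auto
    have "(\<lambda>n. quad Q x + quad R (?K (F n) *v x) + \<gamma> * quad (F n) (A *v x - B *v (?K (F n) *v x)))
      \<longlonglongrightarrow> quad Q x + quad R (?K S *v x) + \<gamma> * quad S (A *v x - B *v (?K S *v x))"
      by (intro tendsto_add tendsto_mult tendsto_const tendsto_quad tendsto_diff
          tendsto_matrix_vector_mult lim K)
    thus "(\<lambda>n. quad (F (Suc n)) x) \<longlonglongrightarrow> quad (riccati_step \<gamma> A B Q R S) x"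
      by (simp add: F_Suc quad_riccati_step Let_def matrix_vector_mult_diff_rdistrib
          matrix_vector_mul_assoc)
    show "(\<lambda>n. quad (F (Suc n)) x) \<longlonglongrightarrow> quad S x" using qlim by (rule LIMSEQ_Suc)
  qed
  thus ?thesis
    using symS psdS symmetric_mat_eqI[OF symmetric_riccati_step[OF Q(1) R(1) symS] symS] by blast
qed

text \<open>Stationarity reads B^T P = 2 R K; this gives the gain and identifies A - (1/2) B R^{-1}
  B^T P as A - B K. Expanding one factor (A - B K)^T of the Joseph form produces - \<gamma> K^T B^T
  S (A - B K) = - K^T R K, which cancels the control term and leaves S = Q + \<gamma> A^T S (A - B
  K). Hence A^T P + 2 Q = 2 S, and the right-hand side of the Riccati equation is 2 \<gamma> S (A -
  B K) = P.\<close>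

lemma riccati_solution:
  assumes R: "symmetric_mat R" "pos_def R" and S: "symmetric_mat S"
    and K: "stationary_gain \<gamma> A B R S K"
    and fp: "S = Q + transpose K ** R ** K + \<gamma> *\<^sub>R (transpose (A - B ** K) ** S ** (A - B ** K))"
    and P: "P = (2 * \<gamma>) *\<^sub>R (S ** (A - B ** K))"
  shows "riccati \<gamma> A B Q R P" "- (gain B R ** P) = K"
proof -
  let ?C = "A - B ** K"
  have inv: "matrix_inv R ** R = mat 1" by (rule pos_def_matrix_inv[OF R(2)])
  have BP: "transpose B ** P = 2 *\<^sub>R (R ** K)"
    using K unfolding stationary_gain_def P
    by (simp add: matrix_mul_assoc scalar_matrix_assoc[symmetric] matrix_scalar_ac)
  have RBP: "matrix_inv R ** transpose B ** P = 2 *\<^sub>R K"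
    by (simp add: matrix_mul_assoc[symmetric] BP matrix_scalar_ac scalar_matrix_assoc[symmetric])
       (simp add: matrix_mul_assoc inv)
  have "gain B R ** P = - K"
    unfolding gain_def scalar_matrix_assoc[symmetric] RBP by simp
  thus "- (gain B R ** P) = K" by simp
  have cl: "A - (1 / 2) *\<^sub>R (B ** matrix_inv R ** transpose B ** P) = ?C"
    by (simp add: matrix_mul_assoc[symmetric] RBP[unfolded matrix_mul_assoc[symmetric]]
        matrix_scalar_ac scalar_matrix_assoc[symmetric])
  have "\<gamma> *\<^sub>R (transpose ?C ** S ** ?C)
      = \<gamma> *\<^sub>R (transpose A ** (S ** ?C)) - transpose K ** (\<gamma> *\<^sub>R (transpose B ** S ** ?C))"
    by (simp add: matrix_eq matrix_vector_distribs transpose_diff matrix_transpose_mul scaleR_diff_right)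
  also have "\<dots> = \<gamma> *\<^sub>R (transpose A ** (S ** ?C)) - transpose K ** R ** K"
    unfolding K[unfolded stationary_gain_def, symmetric] by (simp add: matrix_mul_assoc)
  finally have "S = Q + \<gamma> *\<^sub>R (transpose A ** (S ** ?C))"
    by (subst fp) simp
  hence "2 *\<^sub>R S = 2 *\<^sub>R Q + 2 *\<^sub>R \<gamma> *\<^sub>R (transpose A ** (S ** ?C))"
    by (metis scaleR_right_distrib)
  hence "transpose A ** P + 2 *\<^sub>R Q = 2 *\<^sub>R S"
    by (simp add: P matrix_scalar_ac scalar_matrix_assoc[symmetric])
  thus "riccati \<gamma> A B Q R P"
    unfolding riccati_def cl by (simp add: P scalar_matrix_assoc[symmetric])
qed

section \<open>Discounted linear-quadratic systems\<close>

definition square_integrable :: "'a measure \<Rightarrow> ('a \<Rightarrow> 'b::euclidean_space) \<Rightarrow> bool" where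
  "square_integrable M f \<longleftrightarrow> f \<in> borel_measurable M \<and> integrable M (\<lambda>\<omega>. (norm (f \<omega>))\<^sup>2)"

lemma square_integrable_measurable: "square_integrable M f \<Longrightarrow> f \<in> borel_measurable M"
  by (simp add: square_integrable_def)

lemma square_integrable_bound:
  assumes "square_integrable M g" "f \<in> borel_measurable M" "\<And>\<omega>. norm (f \<omega>) \<le> c * norm (g \<omega>)"
  shows "square_integrable M f"
  unfolding square_integrable_def
proof (intro conjI assms(2), rule Bochner_Integration.integrable_bound)
  show "integrable M (\<lambda>\<omega>. c\<^sup>2 * (norm (g \<omega>))\<^sup>2)"
    using assms(1) by (simp add: square_integrable_def)
  have "(norm (f \<omega>))\<^sup>2 \<le> c\<^sup>2 * (norm (g \<omega>))\<^sup>2" for \<omega>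
    using power_mono[OF assms(3) norm_ge_zero] by (simp add: power_mult_distrib)
  thus "AE \<omega> in M. norm ((norm (f \<omega>))\<^sup>2) \<le> norm (c\<^sup>2 * (norm (g \<omega>))\<^sup>2)" by simp
qed (use assms(2) in measurable)

text \<open>Young's inequality. The parameter stays free because \<open>summable_y\<close> needs the
  factor of the first square arbitrarily close to 1, to preserve \<gamma> |A|^2 < 1; elsewhere the
  value 1 serves.\<close>

lemma norm_add_squared_le:
  fixes x y :: "'b::real_inner"
  assumes "0 < \<eta>"
  shows "(norm (x + y))\<^sup>2 \<le> (1 + \<eta>) * (norm x)\<^sup>2 + (1 + 1 / \<eta>) * (norm y)\<^sup>2"
proof -
  have "0 \<le> (sqrt \<eta> * norm x - norm y / sqrt \<eta>)\<^sup>2" by simp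
  also have "\<dots> = \<eta> * (norm x)\<^sup>2 - 2 * (norm x * norm y) + (norm y)\<^sup>2 / \<eta>"
    using assms by (simp add: power2_diff power_mult_distrib power_divide)
  finally have "2 * (norm x * norm y) \<le> \<eta> * (norm x)\<^sup>2 + (norm y)\<^sup>2 / \<eta>" by simp
  moreover have "(norm (x + y))\<^sup>2 \<le> (norm x + norm y)\<^sup>2"
    by (intro power_mono norm_triangle_ineq) simp
  ultimately show ?thesis by (simp add: power2_sum algebra_simps)
qed

lemma square_integrable_add:
  assumes "square_integrable M f" "square_integrable M g"
  shows "square_integrable M (\<lambda>\<omega>. f \<omega> + g \<omega>)"
  unfolding square_integrable_def
proof (intro conjI, goal_cases)
  case 1
  show ?case using assms by (intro borel_measurable_add) (auto simp: square_integrable_def)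
  have [measurable]: "f \<in> borel_measurable M" "g \<in> borel_measurable M"
    using assms by (auto simp: square_integrable_def)
  case 2
  show ?case
  proof (rule Bochner_Integration.integrable_bound)
    show "integrable M (\<lambda>\<omega>. 2 * (norm (f \<omega>))\<^sup>2 + 2 * (norm (g \<omega>))\<^sup>2)"
      using assms by (auto simp: square_integrable_def)
    show "AE \<omega> in M. norm ((norm (f \<omega> + g \<omega>))\<^sup>2) \<le> norm (2 * (norm (f \<omega>))\<^sup>2 + 2 * (norm (g \<omega>))\<^sup>2)"
      by (intro AE_I2) (use norm_add_squared_le[of 1] in simp)
  qed measurable
qed

lemma square_integrable_matrix_vector:
  fixes f :: "'a \<Rightarrow> real ^ 'n" and A :: "real ^ 'n ^ 'm"
  assumes "square_integrable M f"
  shows "square_integrable M (\<lambda>\<omega>. A *v f \<omega>)"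
proof (rule square_integrable_bound[OF assms, where c="onorm ((*v) A)"])
  show "(\<lambda>\<omega>. A *v f \<omega>) \<in> borel_measurable M"
    using assms by (intro borel_measurable_continuous_on[where f="(*v) A"] linear_continuous_on
        matrix_vector_mul_bounded_linear) (simp add: square_integrable_def)
qed (intro onorm matrix_vector_mul_bounded_linear)

lemma square_integrable_minus: "square_integrable M f \<Longrightarrow> square_integrable M (\<lambda>\<omega>. - f \<omega>)"
  by (rule square_integrable_bound[where c=1]) (auto dest: square_integrable_measurable)

lemma square_integrable_diff:
  assumes "square_integrable M f" "square_integrable M g"
  shows "square_integrable M (\<lambda>\<omega>. f \<omega> - g \<omega>)"
  using square_integrable_add[OF assms(1) square_integrable_minus[OF assms(2)]] by simp

lemma square_integrable_cong_AE:
  assumes "square_integrable M f" "g \<in> borel_measurable M" "AE \<omega> in M. f \<omega> = g \<omega>"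
  shows "square_integrable M g"
proof -
  have [measurable]: "f \<in> borel_measurable M" using assms(1) by (rule square_integrable_measurable)
  have "integrable M (\<lambda>\<omega>. (norm (g \<omega>))\<^sup>2)"
    using assms(2) by (subst integrable_cong_AE[where g="\<lambda>\<omega>. (norm (f \<omega>))\<^sup>2"])
      (use assms in \<open>auto simp: square_integrable_def\<close>)
  thus ?thesis using assms(2) by (simp add: square_integrable_def)
qed

lemma integrable_inner:
  assumes "square_integrable M f" "square_integrable M g"
  shows "integrable M (\<lambda>\<omega>. f \<omega> \<bullet> g \<omega>)"
proof (rule Bochner_Integration.integrable_bound)
  have [measurable]: "f \<in> borel_measurable M" "g \<in> borel_measurable M"
    using assms by (auto simp: square_integrable_def)
  show "integrable M (\<lambda>\<omega>. (norm (f \<omega>))\<^sup>2 + (norm (g \<omega>))\<^sup>2)"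
    using assms by (auto simp: square_integrable_def)
  have "\<bar>f \<omega> \<bullet> g \<omega>\<bar> \<le> (norm (f \<omega>))\<^sup>2 + (norm (g \<omega>))\<^sup>2" for \<omega>
  proof -
    have "\<bar>f \<omega> \<bullet> g \<omega>\<bar> \<le> norm (f \<omega>) * norm (g \<omega>)" by (rule Cauchy_Schwarz_ineq2)
    also have "\<dots> \<le> (norm (f \<omega>))\<^sup>2 + (norm (g \<omega>))\<^sup>2"
      using sum_squares_bound[of "norm (f \<omega>)" "norm (g \<omega>)"]
        mult_nonneg_nonneg[OF norm_ge_zero norm_ge_zero, of "f \<omega>" "g \<omega>"] by linarith
    finally show ?thesis .
  qed
  thus "AE \<omega> in M. norm (f \<omega> \<bullet> g \<omega>) \<le> norm ((norm (f \<omega>))\<^sup>2 + (norm (g \<omega>))\<^sup>2)" by simp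
  show "(\<lambda>\<omega>. f \<omega> \<bullet> g \<omega>) \<in> borel_measurable M" by measurable
qed

lemma integrable_quad: "square_integrable M f \<Longrightarrow> integrable M (\<lambda>\<omega>. quad S (f \<omega>))"
  unfolding quad_def by (intro integrable_inner square_integrable_matrix_vector)

lemma borel_measurable_quad [measurable (raw)]:
  "f \<in> borel_measurable M \<Longrightarrow> (\<lambda>\<omega>. quad S (f \<omega>)) \<in> borel_measurable M"
  by (intro borel_measurable_continuous_on[where f="quad S"] continuous_on_quad)

lemma (in finite_measure) square_integrable_imp_integrable:
  assumes "square_integrable M f"
  shows "integrable M f"
proof (rule Bochner_Integration.integrable_bound)
  show "integrable M (\<lambda>\<omega>. 1 + (norm (f \<omega>))\<^sup>2)"
    using assms by (auto simp: square_integrable_def)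
  have "norm (f \<omega>) \<le> 1 + (norm (f \<omega>))\<^sup>2" for \<omega>
    using sum_squares_bound[of 1 "norm (f \<omega>)"] norm_ge_zero[of "f \<omega>"]
    unfolding power_one mult_1_right by linarith
  thus "AE \<omega> in M. norm (f \<omega>) \<le> norm (1 + (norm (f \<omega>))\<^sup>2)" by simp
qed (use assms in \<open>simp add: square_integrable_def\<close>)

lemma square_integrable_component:
  fixes f :: "'a \<Rightarrow> real ^ 'n"
  assumes "square_integrable M f"
  shows "square_integrable M (\<lambda>\<omega>. f \<omega> $ i)"
proof (rule square_integrable_bound[OF assms, where c=1])
  show "(\<lambda>\<omega>. f \<omega> $ i) \<in> borel_measurable M"
    using square_integrable_measurable[OF assms] by (simp add: cart_eq_inner_axis)
qed (simp add: component_le_norm_cart)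

lemma square_integrable_vecI:
  fixes f :: "'a \<Rightarrow> real ^ 'n"
  assumes "\<And>i. square_integrable M (\<lambda>\<omega>. f \<omega> $ i)"
  shows "square_integrable M f"
proof -
  have [measurable]: "\<And>i. (\<lambda>\<omega>. f \<omega> $ i) \<in> borel_measurable M"
    using assms by (simp add: square_integrable_def)
  have "f \<in> borel_measurable M"
    by (subst borel_measurable_euclidean_space) (auto simp: Basis_vec_def inner_axis)
  moreover have "integrable M (\<lambda>\<omega>. (norm (f \<omega>))\<^sup>2)"
    using assms by (simp add: norm_vec_def L2_set_def sum_nonneg square_integrable_def)
  ultimately show ?thesis by (simp add: square_integrable_def)
qed

lemma quad_mat_1: "quad (mat 1) x = (norm x)\<^sup>2"
  by (simp add: quad_def power2_norm_eq_inner)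

lemma symmetric_mat_1: "symmetric_mat (mat 1)"
  by (simp add: symmetric_mat_def)

text \<open>Summing the recursion, a bound c on one partial sum yields the bound m_0 + \<rho> c +
  (sum of p) on the next. The constant in the proof is the fixed point of this map, so it bounds all
  partial sums.\<close>

lemma summable_contraction_perturbed:
  fixes m p :: "nat \<Rightarrow> real"
  assumes m: "\<And>t. 0 \<le> m t" and p: "\<And>t. 0 \<le> p t" "summable p" and \<rho>: "0 \<le> \<rho>" "\<rho> < 1"
    and step: "\<And>t. m (Suc t) \<le> \<rho> * m t + p t"
  shows "summable m"
proof -
  define c where "c = (m 0 + suminf p) / (1 - \<rho>)"
  have c: "m 0 + (\<rho> * c + suminf p) = c" using \<rho> by (simp add: c_def field_simps)
  have "0 \<le> c" using m[of 0] suminf_nonneg[OF p(2,1)] \<rho> by (auto simp: c_def)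
  have "sum m {..<n} \<le> c" for n
  proof (induction n)
    case (Suc n)
    have "sum m {..<Suc n} = m 0 + (\<Sum>t<n. m (Suc t))" by (rule sum.lessThan_Suc_shift)
    also have "(\<Sum>t<n. m (Suc t)) \<le> \<rho> * sum m {..<n} + sum p {..<n}"
      using sum_mono[of "{..<n}" "\<lambda>t. m (Suc t)" "\<lambda>t. \<rho> * m t + p t"] step
      by (simp add: sum.distrib sum_distrib_left)
    also have "\<dots> \<le> \<rho> * c + suminf p"
      using Suc \<rho> p by (intro add_mono mult_left_mono sum_le_suminf) auto
    finally show ?case using c by simp
  qed (use \<open>0 \<le> c\<close> in simp)
  thus ?thesis using m by (intro bounded_imp_summable[where B=c]) (auto simp only: lessThan_Suc_atMost[symmetric])
qed

text \<open>The common abstraction of the deviation and of the conditional mean; both are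
  interpretations. The recursion holds almost everywhere since conditional expectations are
  determined only up to null sets, which is also why measurability of \<open>y\<close> is assumed
  separately. The noise enters through orthogonality to the current state and control.\<close>

locale lq_system = prob_space M
  for M :: "'a measure" +
  fixes \<gamma> :: real and A Q S :: "real ^ 'd ^ 'd" and B :: "real ^ 'l ^ 'd"
    and R :: "real ^ 'l ^ 'l" and K :: "real ^ 'd ^ 'l"
    and y e :: "nat \<Rightarrow> 'a \<Rightarrow> real ^ 'd" and v :: "nat \<Rightarrow> 'a \<Rightarrow> real ^ 'l"
  assumes discount: "0 < \<gamma>" "\<gamma> < 1" "\<gamma> * (spectral_norm A)\<^sup>2 < 1"
    and weights: "pos_semidef Q" "symmetric_mat R" "pos_def R" "symmetric_mat S" "pos_semidef S"
    and gain: "stationary_gain \<gamma> A B R S K"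
    and value_matrix: "S = Q + transpose K ** R ** K + \<gamma> *\<^sub>R (transpose (A - B ** K) ** S ** (A - B ** K))"
    and y_0: "square_integrable M (y 0)" and y_measurable: "\<And>t. y t \<in> borel_measurable M"
    and v: "\<And>t. square_integrable M (v t)" and e: "\<And>t. square_integrable M (e (Suc t))"
    and e_distr: "\<And>t. distr M borel (e (Suc t)) = distr M borel (e (Suc 0))"
    and y_Suc: "\<And>t. AE \<omega> in M. y (Suc t) \<omega> = A *v y t \<omega> + B *v v t \<omega> + e (Suc t) \<omega>"
    and y_uncorrelated: "\<And>t T. (\<integral>\<omega>. y t \<omega> \<bullet> (T *v e (Suc t) \<omega>) \<partial>M) = 0"
    and v_uncorrelated: "\<And>t T. (\<integral>\<omega>. v t \<omega> \<bullet> (T *v e (Suc t) \<omega>) \<partial>M) = 0"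
begin

definition "stage_cost t = (\<integral>\<omega>. quad Q (y t \<omega>) + quad R (v t \<omega>) \<partial>M)"
text \<open>The expected square left over by \<open>complete_square\<close>: the price at time t of
  deviating from the feedback law.\<close>

definition "gap t = (\<integral>\<omega>. quad (R + \<gamma> *\<^sub>R (transpose B ** S ** B)) (v t \<omega> + K *v y t \<omega>) \<partial>M)"
text \<open>The optimal value. The noise entering at time t + 1 costs its \<open>S\<close>-form at
  weight \<gamma>^(t+1), and these weights add up to \<gamma> / (1 - \<gamma>).\<close>

definition "base_cost = (\<integral>\<omega>. quad S (y 0 \<omega>) \<partial>M) + \<gamma> / (1 - \<gamma>) * (\<integral>\<omega>. quad S (e (Suc 0) \<omega>) \<partial>M)"

lemma y: "square_integrable M (y t)"
proof (induction t)
  case (Suc t)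
  have "square_integrable M (\<lambda>\<omega>. A *v y t \<omega> + B *v v t \<omega> + e (Suc t) \<omega>)"
    by (intro square_integrable_add square_integrable_matrix_vector Suc v e)
  thus ?case by (rule square_integrable_cong_AE) (use y_measurable y_Suc in \<open>auto simp: eq_commute\<close>)
qed (rule y_0)

lemmas L2_intros = square_integrable_add square_integrable_matrix_vector y v e

lemma integral_quad_e: "(\<integral>\<omega>. quad T (e (Suc t) \<omega>) \<partial>M) = (\<integral>\<omega>. quad T (e (Suc 0) \<omega>) \<partial>M)"
proof -
  have [measurable]: "e (Suc t) \<in> borel_measurable M" for t
    using e by (rule square_integrable_measurable)
  have "(\<integral>\<omega>. quad T (e (Suc t) \<omega>) \<partial>M) = integral\<^sup>L (distr M borel (e (Suc t))) (quad T)" for t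
    by (subst integral_distr) auto
  thus ?thesis by (metis e_distr)
qed

text \<open>The cross term between noise and drift vanishes. Transposing \<open>A\<close> and
  \<open>B\<close> to the noise side changes the matrix between the two vectors, hence orthogonality
  is assumed with an arbitrary matrix.\<close>

lemma integral_quad_y_Suc:
  assumes T: "symmetric_mat T"
  shows "(\<integral>\<omega>. quad T (y (Suc t) \<omega>) \<partial>M)
    = (\<integral>\<omega>. quad T (A *v y t \<omega> + B *v v t \<omega>) \<partial>M) + (\<integral>\<omega>. quad T (e (Suc 0) \<omega>) \<partial>M)"
proof -
  let ?c = "\<lambda>\<omega>. A *v y t \<omega> + B *v v t \<omega>"
  have [measurable]: "y t \<in> borel_measurable M" "v t \<in> borel_measurable M" "e (Suc t) \<in> borel_measurable M"
      "?c \<in> borel_measurable M" for t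
    by (auto intro!: square_integrable_measurable L2_intros)
  have "(\<integral>\<omega>. ?c \<omega> \<bullet> (T *v e (Suc t) \<omega>) \<partial>M)
      = (\<integral>\<omega>. y t \<omega> \<bullet> ((transpose A ** T) *v e (Suc t) \<omega>)
          + v t \<omega> \<bullet> ((transpose B ** T) *v e (Suc t) \<omega>) \<partial>M)"
    by (simp add: inner_add_left matrix_vector_mul_assoc[symmetric] inner_matrix_vector_transpose[of "y t _" "transpose A"]
      inner_matrix_vector_transpose[of "v t _" "transpose B"])
  also have "\<dots> = 0"
    by (simp add: integrable_inner L2_intros y_uncorrelated v_uncorrelated)
  finally have cross: "(\<integral>\<omega>. ?c \<omega> \<bullet> (T *v e (Suc t) \<omega>) \<partial>M) = 0" .
  have "(\<integral>\<omega>. quad T (y (Suc t) \<omega>) \<partial>M) = (\<integral>\<omega>. quad T (?c \<omega> + e (Suc t) \<omega>) \<partial>M)"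
  proof (rule integral_cong_AE)
    show "AE \<omega> in M. quad T (y (Suc t) \<omega>) = quad T (?c \<omega> + e (Suc t) \<omega>)"
      using y_Suc[of t] by eventually_elim simp
  qed measurable
  also have "\<dots> = (\<integral>\<omega>. quad T (?c \<omega>) + 2 * (?c \<omega> \<bullet> (T *v e (Suc t) \<omega>)) + quad T (e (Suc t) \<omega>) \<partial>M)"
    by (simp only: quad_add[OF T])
  also have "\<dots> = (\<integral>\<omega>. quad T (?c \<omega>) \<partial>M) + 2 * (\<integral>\<omega>. ?c \<omega> \<bullet> (T *v e (Suc t) \<omega>) \<partial>M)
      + (\<integral>\<omega>. quad T (e (Suc t) \<omega>) \<partial>M)"
    by (simp add: integrable_quad integrable_inner L2_intros)
  finally show ?thesis unfolding cross integral_quad_e[of T t] by simp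
qed

text \<open>Completing the square pointwise and using the Joseph equation for \<open>S\<close> gives
  the Bellman identity with remainder; integrating it adds the mean noise cost.\<close>

lemma one_step:
  "stage_cost t + \<gamma> * (\<integral>\<omega>. quad S (y (Suc t) \<omega>) \<partial>M)
    = (\<integral>\<omega>. quad S (y t \<omega>) \<partial>M) + \<gamma> * (\<integral>\<omega>. quad S (e (Suc 0) \<omega>) \<partial>M) + gap t"
proof -
  let ?N = "R + \<gamma> *\<^sub>R (transpose B ** S ** B)"
  have S: "quad S x = quad Q x + quad R (K *v x) + \<gamma> * quad S ((A - B ** K) *v x)" for x
    by (subst value_matrix, unfold quad_add_mat quad_scaleR_mat quad_matrix_vector[symmetric]) (rule refl)
  have "quad Q x + quad R u + \<gamma> * quad S (A *v x + B *v u) = quad S x + quad ?N (u + K *v x)" for x u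
    using complete_square[OF weights(4,2) gain, of u x] S[of x] by linarith
  hence "(\<integral>\<omega>. quad Q (y t \<omega>) + quad R (v t \<omega>) + \<gamma> * quad S (A *v y t \<omega> + B *v v t \<omega>) \<partial>M)
      = (\<integral>\<omega>. quad S (y t \<omega>) + quad ?N (v t \<omega> + K *v y t \<omega>) \<partial>M)" by simp
  thus ?thesis unfolding integral_quad_y_Suc[OF weights(4)] stage_cost_def gap_def
    by (simp add: integrable_quad L2_intros distrib_left)
qed

text \<open>Telescoping of \<open>one_step\<close> with weights \<gamma>^t. It is an identity, so it
  serves both to bound the cost (zero gap) and to evaluate it (in the limit).\<close>

lemma finite_horizon:
  "(\<Sum>t<n. \<gamma> ^ t * stage_cost t) + \<gamma> ^ n * (\<integral>\<omega>. quad S (y n \<omega>) \<partial>M)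
    = (\<integral>\<omega>. quad S (y 0 \<omega>) \<partial>M) + (\<Sum>t<n. \<gamma> ^ t) * (\<gamma> * (\<integral>\<omega>. quad S (e (Suc 0) \<omega>) \<partial>M))
      + (\<Sum>t<n. \<gamma> ^ t * gap t)"
proof (induction n)
  case (Suc n)
  have "\<gamma> ^ n * stage_cost n + \<gamma> ^ Suc n * (\<integral>\<omega>. quad S (y (Suc n) \<omega>) \<partial>M)
      = \<gamma> ^ n * (stage_cost n + \<gamma> * (\<integral>\<omega>. quad S (y (Suc n) \<omega>) \<partial>M))"
    by (simp add: algebra_simps)
  also have "\<dots> = \<gamma> ^ n * (\<integral>\<omega>. quad S (y n \<omega>) \<partial>M) + \<gamma> ^ n * (\<gamma> * (\<integral>\<omega>. quad S (e (Suc 0) \<omega>) \<partial>M))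
      + \<gamma> ^ n * gap n"
    unfolding one_step by (simp add: algebra_simps)
  finally show ?case using Suc unfolding sum.lessThan_Suc distrib_right by linarith
qed simp

text \<open>Coercivity of \<open>R\<close>; it converts a bound on the cost into a bound on the
  second moments of the control.\<close>

lemma stage_cost_lower: "\<exists>r>0. \<forall>t. r * (\<integral>\<omega>. (norm (v t \<omega>))\<^sup>2 \<partial>M) \<le> stage_cost t"
proof -
  obtain r where r: "r > 0" "\<And>x. r * (norm x)\<^sup>2 \<le> quad R x" using pos_def_coercive[OF weights(3)] by auto
  have "r * (\<integral>\<omega>. (norm (v t \<omega>))\<^sup>2 \<partial>M) \<le> stage_cost t" for t
  proof -
    have "r * (\<integral>\<omega>. (norm (v t \<omega>))\<^sup>2 \<partial>M) = (\<integral>\<omega>. r * (norm (v t \<omega>))\<^sup>2 \<partial>M)" by simp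
    also have "\<dots> \<le> stage_cost t" unfolding stage_cost_def
    proof (rule integral_mono)
      show "integrable M (\<lambda>\<omega>. r * (norm (v t \<omega>))\<^sup>2)" using v by (auto simp: square_integrable_def)
      show "r * (norm (v t \<omega>))\<^sup>2 \<le> quad Q (y t \<omega>) + quad R (v t \<omega>)" for \<omega>
        using r(2)[of "v t \<omega>"] weights(1) by (auto simp: pos_semidef_def add_increasing)
    qed (simp add: integrable_quad L2_intros)
    finally show ?thesis .
  qed
  thus ?thesis using r(1) by blast
qed

lemma stage_cost_nonneg: "0 \<le> stage_cost t"
  unfolding stage_cost_def using weights(1) pos_def_imp_semidef[OF weights(3)]
  by (intro Bochner_Integration.integral_nonneg) (auto simp: pos_semidef_def)

lemma pos_def_gap_matrix: "pos_def (R + \<gamma> *\<^sub>R (transpose B ** S ** B))"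
  using pos_def_add_congruence[OF weights(3,5)] discount by simp

lemma gap_nonneg: "0 \<le> gap t"
  unfolding gap_def using pos_def_imp_semidef[OF pos_def_gap_matrix]
  by (intro Bochner_Integration.integral_nonneg) (auto simp: pos_semidef_def)

text \<open>The weight of the square is positive definite, so a vanishing expectation forces the
  vector itself to vanish almost surely. This is the source of both the feedback form and
  uniqueness.\<close>

lemma gap_eq_0_iff: "gap t = 0 \<longleftrightarrow> (AE \<omega> in M. v t \<omega> = - (K *v y t \<omega>))"
proof -
  let ?N = "R + \<gamma> *\<^sub>R (transpose B ** S ** B)"
  have "0 \<le> quad ?N x" for x
    using pos_def_imp_semidef[OF pos_def_gap_matrix] by (auto simp: pos_semidef_def)
  hence "gap t = 0 \<longleftrightarrow> (AE \<omega> in M. quad ?N (v t \<omega> + K *v y t \<omega>) = 0)"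
    unfolding gap_def by (simp add: integral_nonneg_eq_0_iff_AE integrable_quad L2_intros)
  moreover have "quad ?N x = 0 \<longleftrightarrow> x = 0" for x
    using pos_defD[OF pos_def_gap_matrix, of x] by (cases "x = 0") (auto simp: quad_def)
  ultimately show ?thesis by (simp add: eq_neg_iff_add_eq_0)
qed

lemma geometric_sum_le: "(\<Sum>t<n. \<gamma> ^ t) \<le> 1 / (1 - \<gamma>)"
  using sum_le_suminf[of "\<lambda>t. \<gamma> ^ t" "{..<n}"] suminf_geometric[of \<gamma>] discount
  by (auto simp: summable_geometric)

text \<open>Here summability of the control is the conclusion, so the boundary term cannot yet be
  sent to 0; being nonnegative it is dropped from \<open>finite_horizon\<close> instead.\<close>

lemma summable_of_zero_gap:
  assumes "\<And>t. gap t = 0"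
  shows "summable (\<lambda>t. \<gamma> ^ t * (\<integral>\<omega>. (norm (v t \<omega>))\<^sup>2 \<partial>M))"
proof -
  obtain r where r: "r > 0" "\<And>t. r * (\<integral>\<omega>. (norm (v t \<omega>))\<^sup>2 \<partial>M) \<le> stage_cost t"
    using stage_cost_lower by auto
  have S: "0 \<le> (\<integral>\<omega>. quad S (f \<omega>) \<partial>M)" for f
    using weights(5) by (intro Bochner_Integration.integral_nonneg) (auto simp: pos_semidef_def)
  have "(\<Sum>t<n. \<gamma> ^ t * stage_cost t) \<le> base_cost" for n
  proof -
    have "(\<Sum>t<n. \<gamma> ^ t) * (\<gamma> * (\<integral>\<omega>. quad S (e (Suc 0) \<omega>) \<partial>M))
        \<le> 1 / (1 - \<gamma>) * (\<gamma> * (\<integral>\<omega>. quad S (e (Suc 0) \<omega>) \<partial>M))"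
      using S discount by (intro mult_right_mono geometric_sum_le) auto
    moreover have "0 \<le> \<gamma> ^ n * (\<integral>\<omega>. quad S (y n \<omega>) \<partial>M)" using S discount by auto
    ultimately show ?thesis using finite_horizon[of n] by (simp add: base_cost_def assms)
  qed
  hence "summable (\<lambda>t. \<gamma> ^ t * stage_cost t)"
    using stage_cost_nonneg discount
    by (intro bounded_imp_summable[where B=base_cost]) (simp, simp only: lessThan_Suc_atMost[symmetric])
  hence "summable (\<lambda>t. (1 / r) * (\<gamma> ^ t * stage_cost t))" by (rule summable_mult)
  thus ?thesis
  proof (rule summable_comparison_test_ev[rotated], intro always_eventually allI)
    fix t
    have "(\<integral>\<omega>. (norm (v t \<omega>))\<^sup>2 \<partial>M) \<le> stage_cost t / r" using r by (simp add: field_simps)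
    from mult_left_mono[OF this, of "\<gamma> ^ t"]
    show "norm (\<gamma> ^ t * (\<integral>\<omega>. (norm (v t \<omega>))\<^sup>2 \<partial>M)) \<le> 1 / r * (\<gamma> ^ t * stage_cost t)"
      using discount by simp
  qed
qed

lemma summable_y:
  assumes "summable (\<lambda>t. \<gamma> ^ t * (\<integral>\<omega>. (norm (v t \<omega>))\<^sup>2 \<partial>M))"
  shows "summable (\<lambda>t. \<gamma> ^ t * (\<integral>\<omega>. (norm (y t \<omega>))\<^sup>2 \<partial>M))"
proof -
  \<comment> \<open>Half of the slack in a = \<gamma> |A|^2 < 1: then (1 + \<eta>) a \<le> a +
    \<eta> = (1 + a) / 2 < 1.\<close>
  define \<eta> where "\<eta> = (1 - \<gamma> * (spectral_norm A)\<^sup>2) / 2"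
  define \<rho> where "\<rho> = (1 + \<eta>) * (\<gamma> * (spectral_norm A)\<^sup>2)"
  define s where "s = (\<integral>\<omega>. (norm (e (Suc 0) \<omega>))\<^sup>2 \<partial>M)"
  let ?b = "(1 + 1 / \<eta>) * (spectral_norm B)\<^sup>2"
  let ?Ey = "\<lambda>t. \<integral>\<omega>. (norm (y t \<omega>))\<^sup>2 \<partial>M" and ?Ev = "\<lambda>t. \<integral>\<omega>. (norm (v t \<omega>))\<^sup>2 \<partial>M"
  have \<eta>: "0 < \<eta>" using discount by (simp add: \<eta>_def)
  have \<rho>: "0 \<le> \<rho>" "\<rho> < 1"
  proof -
    show "0 \<le> \<rho>" using \<eta> discount by (simp add: \<rho>_def)
    have "\<eta> * (\<gamma> * (spectral_norm A)\<^sup>2) \<le> \<eta> * 1" using \<eta> discount by (intro mult_left_mono) auto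
    hence "\<rho> \<le> \<eta> + \<gamma> * (spectral_norm A)\<^sup>2" by (simp add: \<rho>_def distrib_right)
    also have "\<dots> < 1" using discount by (simp add: \<eta>_def field_simps)
    finally show "\<rho> < 1" .
  qed
  have op: "(norm (C *v x))\<^sup>2 \<le> (spectral_norm C)\<^sup>2 * (norm x)\<^sup>2" for C :: "real ^ 'i ^ 'j" and x
    unfolding spectral_norm_def power_mult_distrib[symmetric]
    by (intro power_mono onorm matrix_vector_mul_bounded_linear) simp
  have int: "integrable M (\<lambda>\<omega>. (norm (f \<omega>))\<^sup>2)" if "square_integrable M f" for f :: "'a \<Rightarrow> real ^ 'i"
    using that by (simp add: square_integrable_def)
  have Suc: "?Ey (Suc t) \<le> (1 + \<eta>) * (spectral_norm A)\<^sup>2 * ?Ey t + ?b * ?Ev t + s" for t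
  proof -
    \<comment> \<open>With the identity as weight, the variance splitting separates the noise
      exactly; Young's inequality is spent on the state and control terms alone.\<close>
    have "?Ey (Suc t) = (\<integral>\<omega>. (norm (A *v y t \<omega> + B *v v t \<omega>))\<^sup>2 \<partial>M) + s"
      using integral_quad_y_Suc[OF symmetric_mat_1] by (simp add: quad_mat_1 s_def)
    also have "(\<integral>\<omega>. (norm (A *v y t \<omega> + B *v v t \<omega>))\<^sup>2 \<partial>M)
        \<le> (\<integral>\<omega>. (1 + \<eta>) * (spectral_norm A)\<^sup>2 * (norm (y t \<omega>))\<^sup>2 + ?b * (norm (v t \<omega>))\<^sup>2 \<partial>M)"
    proof (rule integral_mono)
      fix \<omega>
      have "(norm (A *v y t \<omega> + B *v v t \<omega>))\<^sup>2
          \<le> (1 + \<eta>) * (norm (A *v y t \<omega>))\<^sup>2 + (1 + 1 / \<eta>) * (norm (B *v v t \<omega>))\<^sup>2"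
        by (rule norm_add_squared_le[OF \<eta>])
      also have "\<dots> \<le> (1 + \<eta>) * ((spectral_norm A)\<^sup>2 * (norm (y t \<omega>))\<^sup>2)
          + (1 + 1 / \<eta>) * ((spectral_norm B)\<^sup>2 * (norm (v t \<omega>))\<^sup>2)"
        using \<eta> by (intro add_mono mult_left_mono op) auto
      finally show "(norm (A *v y t \<omega> + B *v v t \<omega>))\<^sup>2
          \<le> (1 + \<eta>) * (spectral_norm A)\<^sup>2 * (norm (y t \<omega>))\<^sup>2 + ?b * (norm (v t \<omega>))\<^sup>2"
        by (simp add: mult.assoc)
    qed (simp_all add: int L2_intros)
    also have "\<dots> = (1 + \<eta>) * (spectral_norm A)\<^sup>2 * ?Ey t + ?b * ?Ev t"
      by (simp add: int L2_intros)
    finally show ?thesis by simp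
  qed
  show ?thesis
  proof (rule summable_contraction_perturbed[OF _ _ _ \<rho>])
    show "summable (\<lambda>t. \<gamma> * ?b * (\<gamma> ^ t * ?Ev t) + \<gamma> * s * \<gamma> ^ t)"
      using discount by (intro summable_add summable_mult assms summable_geometric) auto
    show "0 \<le> \<gamma> * ?b * (\<gamma> ^ t * ?Ev t) + \<gamma> * s * \<gamma> ^ t" for t
      using \<eta> discount by (simp add: s_def)
    show "\<gamma> ^ Suc t * ?Ey (Suc t) \<le> \<rho> * (\<gamma> ^ t * ?Ey t) + (\<gamma> * ?b * (\<gamma> ^ t * ?Ev t) + \<gamma> * s * \<gamma> ^ t)" for t
      using mult_left_mono[OF Suc[of t], of "\<gamma> ^ Suc t"] discount by (simp add: \<rho>_def algebra_simps)
  qed (use discount in simp)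
qed

text \<open>In \<open>finite_horizon\<close> the stage costs are dominated by summable second
  moments and the boundary term by a single term of such a series. Everything except the gap sum is
  thus known to converge, and the identity forces the gap sum to converge as well.\<close>

lemma infinite_horizon:
  assumes v_sum: "summable (\<lambda>t. \<gamma> ^ t * (\<integral>\<omega>. (norm (v t \<omega>))\<^sup>2 \<partial>M))"
  shows "summable (\<lambda>t. \<gamma> ^ t * stage_cost t)" "summable (\<lambda>t. \<gamma> ^ t * gap t)"
    "(\<Sum>t. \<gamma> ^ t * stage_cost t) = base_cost + (\<Sum>t. \<gamma> ^ t * gap t)"
proof -
  let ?Ey = "\<lambda>t. \<integral>\<omega>. (norm (y t \<omega>))\<^sup>2 \<partial>M" and ?Ev = "\<lambda>t. \<integral>\<omega>. (norm (v t \<omega>))\<^sup>2 \<partial>M"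
  note y_sum = summable_y[OF v_sum]
  have quad_le: "(\<integral>\<omega>. quad T (f \<omega>) \<partial>M) \<le> onorm ((*v) T) * (\<integral>\<omega>. (norm (f \<omega>))\<^sup>2 \<partial>M)"
    if "square_integrable M f" for T :: "real ^ 'i ^ 'i" and f
  proof -
    have "(\<integral>\<omega>. quad T (f \<omega>) \<partial>M) \<le> (\<integral>\<omega>. onorm ((*v) T) * (norm (f \<omega>))\<^sup>2 \<partial>M)"
      using that by (intro integral_mono quad_upper_bound integrable_quad)
        (auto simp: square_integrable_def)
    thus ?thesis by simp
  qed
  show cost: "summable (\<lambda>t. \<gamma> ^ t * stage_cost t)"
  proof (rule summable_comparison_test_ev)
    show "summable (\<lambda>t. onorm ((*v) Q) * (\<gamma> ^ t * ?Ey t) + onorm ((*v) R) * (\<gamma> ^ t * ?Ev t))"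
      by (intro summable_add summable_mult y_sum v_sum)
    have "stage_cost t \<le> onorm ((*v) Q) * ?Ey t + onorm ((*v) R) * ?Ev t" for t
      using quad_le[OF y, of Q t] quad_le[OF v, of R t] by (simp add: stage_cost_def integrable_quad y v)
    hence "\<gamma> ^ t * stage_cost t \<le> \<gamma> ^ t * (onorm ((*v) Q) * ?Ey t + onorm ((*v) R) * ?Ev t)" for t
      using discount by (intro mult_left_mono) auto
    thus "\<forall>\<^sub>F t in sequentially. norm (\<gamma> ^ t * stage_cost t)
        \<le> onorm ((*v) Q) * (\<gamma> ^ t * ?Ey t) + onorm ((*v) R) * (\<gamma> ^ t * ?Ev t)"
      using discount stage_cost_nonneg by (simp add: abs_mult algebra_simps)
  qed
  have "(\<lambda>n. \<gamma> ^ n * (\<integral>\<omega>. quad S (y n \<omega>) \<partial>M)) \<longlonglongrightarrow> 0"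
  proof (rule tendsto_sandwich[OF _ _ tendsto_const])
    have "0 \<le> (\<integral>\<omega>. quad S (y n \<omega>) \<partial>M)" for n
      using weights(5) by (intro Bochner_Integration.integral_nonneg) (auto simp: pos_semidef_def)
    thus "\<forall>\<^sub>F n in sequentially. 0 \<le> \<gamma> ^ n * (\<integral>\<omega>. quad S (y n \<omega>) \<partial>M)" using discount by simp
    show "\<forall>\<^sub>F n in sequentially. \<gamma> ^ n * (\<integral>\<omega>. quad S (y n \<omega>) \<partial>M) \<le> onorm ((*v) S) * (\<gamma> ^ n * ?Ey n)"
      using quad_le[OF y, of S] discount
      by (intro always_eventually allI) (simp add: mult.left_commute)
    show "(\<lambda>n. onorm ((*v) S) * (\<gamma> ^ n * ?Ey n)) \<longlonglongrightarrow> 0"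
      using tendsto_mult_right_zero[OF summable_LIMSEQ_zero[OF y_sum]] by simp
  qed
  moreover have "(\<lambda>n. \<Sum>t<n. \<gamma> ^ t) \<longlonglongrightarrow> 1 / (1 - \<gamma>)"
    using geometric_sums[of \<gamma>] discount by (simp add: sums_def)
  \<comment> \<open>The expression is \<open>finite_horizon\<close> solved for the partial sums of
    the gaps.\<close>
  ultimately have "(\<lambda>n. (\<Sum>t<n. \<gamma> ^ t * stage_cost t) + \<gamma> ^ n * (\<integral>\<omega>. quad S (y n \<omega>) \<partial>M)
      - (\<integral>\<omega>. quad S (y 0 \<omega>) \<partial>M) - (\<Sum>t<n. \<gamma> ^ t) * (\<gamma> * (\<integral>\<omega>. quad S (e (Suc 0) \<omega>) \<partial>M)))
    \<longlonglongrightarrow> (\<Sum>t. \<gamma> ^ t * stage_cost t) + 0 - (\<integral>\<omega>. quad S (y 0 \<omega>) \<partial>M)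
      - 1 / (1 - \<gamma>) * (\<gamma> * (\<integral>\<omega>. quad S (e (Suc 0) \<omega>) \<partial>M))"
    by (intro tendsto_intros summable_LIMSEQ cost)
  hence "(\<lambda>t. \<gamma> ^ t * gap t) sums ((\<Sum>t. \<gamma> ^ t * stage_cost t) - base_cost)"
    unfolding sums_def finite_horizon by (simp add: base_cost_def algebra_simps)
  thus "summable (\<lambda>t. \<gamma> ^ t * gap t)"
    "(\<Sum>t. \<gamma> ^ t * stage_cost t) = base_cost + (\<Sum>t. \<gamma> ^ t * gap t)"
    by (auto simp: sums_iff)
qed

end

section \<open>Conditional expectation and independence\<close>

lemma matrix_vector_component: "(A *v x) $ i = (\<Sum>j\<in>UNIV. A $ i $ j * x $ j)"
  by (simp add: matrix_vector_mult_def)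

context finite_measure_subalgebra
begin

lemma vec_cond_exp_component: "vec_cond_exp M F X \<omega> $ i = real_cond_exp M F (\<lambda>\<omega>. X \<omega> $ i) \<omega>"
  by (simp add: vec_cond_exp_def)

lemma integrable_component:
  fixes X :: "'a \<Rightarrow> real ^ 'n"
  shows "square_integrable M X \<Longrightarrow> integrable M (\<lambda>\<omega>. X \<omega> $ i)"
  by (intro square_integrable_imp_integrable square_integrable_component)

lemma vec_cond_exp_eqI:
  assumes "\<And>i. AE \<omega> in M. real_cond_exp M F (\<lambda>\<omega>. X \<omega> $ i) \<omega> = Y \<omega> $ i"
  shows "AE \<omega> in M. vec_cond_exp M F X \<omega> = Y \<omega>"
proof -
  have "AE \<omega> in M. \<forall>i\<in>UNIV. real_cond_exp M F (\<lambda>\<omega>. X \<omega> $ i) \<omega> = Y \<omega> $ i"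
    by (intro AE_finite_allI assms) auto
  thus ?thesis by eventually_elim (simp add: vec_eq_iff vec_cond_exp_component)
qed

lemma measurable_vec_cond_exp_subalgebra:
  "vec_cond_exp M F X \<in> borel_measurable F"
  by (subst borel_measurable_euclidean_space)
    (auto simp: Basis_vec_def inner_axis vec_cond_exp_component)

lemma measurable_vec_cond_exp: "vec_cond_exp M F X \<in> borel_measurable M"
  by (rule measurable_from_subalg[OF subalg measurable_vec_cond_exp_subalgebra])

text \<open>Conditional Jensen for the square: conditional expectation contracts second
  moments.\<close>

lemma real_cond_exp_square:
  assumes "square_integrable M X"
  shows "integrable M (\<lambda>\<omega>. (real_cond_exp M F X \<omega>)\<^sup>2)"
    and "(\<integral>\<omega>. (real_cond_exp M F X \<omega>)\<^sup>2 \<partial>M) \<le> (\<integral>\<omega>. (X \<omega>)\<^sup>2 \<partial>M)"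
proof -
  have X: "integrable M X" "integrable M (\<lambda>\<omega>. (X \<omega>)\<^sup>2)"
    using assms square_integrable_imp_integrable[OF assms] by (auto simp: square_integrable_def)
  have conv: "convex_on UNIV (\<lambda>x::real. x\<^sup>2)"
    by (rule convex_power2)
  show int: "integrable M (\<lambda>\<omega>. (real_cond_exp M F X \<omega>)\<^sup>2)"
    by (rule integrable_convex_cond_exp[where I=UNIV and q="\<lambda>x. x\<^sup>2"]) (use X conv in auto)
  have "AE \<omega> in M. (real_cond_exp M F X \<omega>)\<^sup>2 \<le> real_cond_exp M F (\<lambda>\<omega>. (X \<omega>)\<^sup>2) \<omega>"
    by (rule real_cond_exp_jensens_inequality(2)[where I=UNIV and q="\<lambda>x. x\<^sup>2"]) (use X conv in auto)
  hence "(\<integral>\<omega>. (real_cond_exp M F X \<omega>)\<^sup>2 \<partial>M) \<le> (\<integral>\<omega>. real_cond_exp M F (\<lambda>\<omega>. (X \<omega>)\<^sup>2) \<omega> \<partial>M)"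
    by (intro integral_mono_AE int real_cond_exp_int X)
  thus "(\<integral>\<omega>. (real_cond_exp M F X \<omega>)\<^sup>2 \<partial>M) \<le> (\<integral>\<omega>. (X \<omega>)\<^sup>2 \<partial>M)"
    by (simp add: real_cond_exp_int X)
qed

lemma norm_squared_components: "(norm (x :: real ^ 'n))\<^sup>2 = (\<Sum>i\<in>UNIV. (x $ i)\<^sup>2)"
  by (simp add: norm_vec_def L2_set_def sum_nonneg)

lemma square_integrable_vec_cond_exp:
  fixes X :: "'a \<Rightarrow> real ^ 'n"
  assumes "square_integrable M X"
  shows "square_integrable M (vec_cond_exp M F X)"
  using real_cond_exp_square(1)[OF square_integrable_component[OF assms]]
  by (simp add: square_integrable_def norm_squared_components vec_cond_exp_component measurable_vec_cond_exp)

lemma norm_vec_cond_exp_le: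
  fixes X :: "'a \<Rightarrow> real ^ 'n"
  assumes "square_integrable M X"
  shows "(\<integral>\<omega>. (norm (vec_cond_exp M F X \<omega>))\<^sup>2 \<partial>M) \<le> (\<integral>\<omega>. (norm (X \<omega>))\<^sup>2 \<partial>M)"
proof -
  note comp = square_integrable_component[OF assms]
  have "integrable M (\<lambda>\<omega>. (X \<omega> $ i)\<^sup>2)" for i
    using comp[of i] by (simp add: square_integrable_def)
  thus ?thesis
    using real_cond_exp_square[OF comp]
    by (simp add: norm_squared_components vec_cond_exp_component sum_mono)
qed

lemma vec_cond_exp_add:
  assumes "square_integrable M X" "square_integrable M Y"
  shows "AE \<omega> in M. vec_cond_exp M F (\<lambda>\<omega>. X \<omega> + Y \<omega>) \<omega> = vec_cond_exp M F X \<omega> + vec_cond_exp M F Y \<omega>"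
  by (rule vec_cond_exp_eqI)
    (simp add: vec_cond_exp_component real_cond_exp_add integrable_component assms)

lemma vec_cond_exp_matrix_vector:
  assumes "square_integrable M X"
  shows "AE \<omega> in M. vec_cond_exp M F (\<lambda>\<omega>. A *v X \<omega>) \<omega> = A *v vec_cond_exp M F X \<omega>"
proof (rule vec_cond_exp_eqI)
  fix i
  have "AE \<omega> in M. real_cond_exp M F (\<lambda>\<omega>. \<Sum>j\<in>UNIV. A $ i $ j * X \<omega> $ j) \<omega>
      = (\<Sum>j\<in>UNIV. real_cond_exp M F (\<lambda>\<omega>. A $ i $ j * X \<omega> $ j) \<omega>)"
    by (intro real_cond_exp_sum integrable_mult_right integrable_component assms)
  moreover have "AE \<omega> in M. \<forall>j\<in>UNIV. real_cond_exp M F (\<lambda>\<omega>. A $ i $ j * X \<omega> $ j) \<omega>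
      = A $ i $ j * real_cond_exp M F (\<lambda>\<omega>. X \<omega> $ j) \<omega>"
    by (intro AE_finite_allI real_cond_exp_cmult integrable_component assms) auto
  ultimately show "AE \<omega> in M. real_cond_exp M F (\<lambda>\<omega>. (A *v X \<omega>) $ i) \<omega> = (A *v vec_cond_exp M F X \<omega>) $ i"
    by eventually_elim (simp add: matrix_vector_component vec_cond_exp_component)
qed

lemma vec_cond_exp_measurable_eq:
  assumes "square_integrable M X" "X \<in> borel_measurable F"
  shows "AE \<omega> in M. vec_cond_exp M F X \<omega> = X \<omega>"
  using assms(2)
  by (intro vec_cond_exp_eqI real_cond_exp_F_meas integrable_component assms(1)) (simp add: cart_eq_inner_axis)

lemma vec_cond_exp_cong:
  assumes "AE \<omega> in M. X \<omega> = Y \<omega>" "X \<in> borel_measurable M" "Y \<in> borel_measurable M"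
  shows "AE \<omega> in M. vec_cond_exp M F X \<omega> = vec_cond_exp M F Y \<omega>"
proof (rule vec_cond_exp_eqI, unfold vec_cond_exp_component, rule real_cond_exp_cong)
  show "AE \<omega> in M. X \<omega> $ i = Y \<omega> $ i" for i using assms(1) by eventually_elim simp
qed (use assms in \<open>simp_all add: cart_eq_inner_axis\<close>)

end

section \<open>Generated sigma-algebras and independence\<close>

lemma space_generated_sigma [simp]: "space (generated_sigma M XS) = space M"
  by (simp add: generated_sigma_def space_measure_of_conv)

lemma sets_generated_sigma:
  "sets (generated_sigma M XS) = sigma_sets (space M) (\<Union>X\<in>XS. {X -` S \<inter> space M | S. S \<in> sets borel})"
  unfolding generated_sigma_def by (rule sets_measure_of) auto

lemma sets_generated_sigma_mono:
  "XS \<subseteq> YS \<Longrightarrow> sets (generated_sigma M XS) \<subseteq> sets (generated_sigma M YS)"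
  unfolding sets_generated_sigma by (intro sigma_sets_mono') auto

lemma measurable_generated_sigma: "X \<in> XS \<Longrightarrow> X \<in> borel_measurable (generated_sigma M XS)"
  by (rule measurableI) (auto simp: sets_generated_sigma)

lemma measurable_generated_sigma_mono:
  "XS \<subseteq> YS \<Longrightarrow> f \<in> measurable (generated_sigma M XS) N \<Longrightarrow> f \<in> measurable (generated_sigma M YS) N"
  using sets_generated_sigma_mono[of XS YS M] by (auto simp: measurable_def)

lemma subalgebra_generated_sigma:
  assumes "XS \<subseteq> borel_measurable M"
  shows "subalgebra M (generated_sigma M XS)"
  unfolding subalgebra_def sets_generated_sigma
  using assms by (auto intro!: sets.sigma_sets_subset measurable_sets)

context prob_space
begin

lemma finite_measure_subalgebra_generated_sigma:
  "XS \<subseteq> borel_measurable M \<Longrightarrow> finite_measure_subalgebra M (generated_sigma M XS)"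
  by (simp add: finite_measure_subalgebra_def finite_measure_subalgebra_axioms_def
      subalgebra_generated_sigma finite_measure_axioms)

text \<open>Grouping of an independent family into two disjoint blocks, which
  \<open>case_bool I J\<close> indexes by the truth values. The preimages under one variable are
  stable under intersection, as the grouping rule requires.\<close>

lemma indep_set_generated_sigma:
  fixes Z :: "'i \<Rightarrow> 'a \<Rightarrow> 'b::topological_space"
  assumes "indep_vars (\<lambda>_. borel) Z UNIV" "I \<inter> J = {}"
  shows "indep_set (sets (generated_sigma M (Z ` I))) (sets (generated_sigma M (Z ` J)))"
proof -
  let ?E = "\<lambda>i. {Z i -` A \<inter> space M | A. A \<in> sets borel}"
  have "indep_sets (\<lambda>b. sigma_sets (space M) (\<Union>i\<in>case_bool I J b. ?E i)) UNIV"
  proof (rule indep_sets_collect_sigma)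
    show "indep_sets ?E (\<Union>b\<in>UNIV. case_bool I J b)"
      using assms(1) by (auto simp: indep_vars_def2 intro: indep_sets_mono_index)
    show "Int_stable (?E i)" for i
    proof (rule Int_stableI, safe)
      fix A B :: "'b set" assume "A \<in> sets borel" "B \<in> sets borel"
      thus "\<exists>C. Z i -` A \<inter> space M \<inter> (Z i -` B \<inter> space M) = Z i -` C \<inter> space M \<and> C \<in> sets borel"
        by (intro exI[of _ "A \<inter> B"]) auto
    qed
    show "disjoint_family_on (case_bool I J) UNIV"
      using assms(2) by (auto simp: disjoint_family_on_def split: bool.split)
  qed
  also have "(\<lambda>b. sigma_sets (space M) (\<Union>i\<in>case_bool I J b. ?E i))
      = case_bool (sets (generated_sigma M (Z ` I))) (sets (generated_sigma M (Z ` J)))"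
    by (auto simp: fun_eq_iff sets_generated_sigma split: bool.split)
  finally show ?thesis unfolding indep_set_def .
qed

lemma
  fixes Z :: "'i \<Rightarrow> 'a \<Rightarrow> 'b::topological_space" and f g :: "'a \<Rightarrow> real"
  assumes indep: "indep_vars (\<lambda>_. borel) Z UNIV" "I \<inter> J = {}"
    and f: "f \<in> borel_measurable (generated_sigma M (Z ` I))" "integrable M f"
    and g: "g \<in> borel_measurable (generated_sigma M (Z ` J))" "integrable M g"
  shows integrable_mult_indep: "integrable M (\<lambda>\<omega>. f \<omega> * g \<omega>)"
    and integral_mult_indep: "(\<integral>\<omega>. f \<omega> * g \<omega> \<partial>M) = (\<integral>\<omega>. f \<omega> \<partial>M) * (\<integral>\<omega>. g \<omega> \<partial>M)"
proof -
  have sub: "sigma_sets (space M) {h -` A \<inter> space M | A. A \<in> sets borel} \<subseteq> sets (generated_sigma M (Z ` L))"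
    if "h \<in> borel_measurable (generated_sigma M (Z ` L))" for h :: "'a \<Rightarrow> real" and L
  proof -
    have "{h -` A \<inter> space M | A. A \<in> sets borel} \<subseteq> sets (generated_sigma M (Z ` L))"
      using measurable_sets[OF that] by auto
    from sets.sigma_sets_subset[OF this] show ?thesis by simp
  qed
  have "indep_set (sigma_sets (space M) {f -` A \<inter> space M | A. A \<in> sets borel})
      (sigma_sets (space M) {g -` A \<inter> space M | A. A \<in> sets borel})"
    using indep_set_generated_sigma[OF indep] sub[OF f(1)] sub[OF g(1)]
    unfolding indep_sets2_eq by blast
  hence "indep_var borel f borel g"
    unfolding indep_var_eq using f(2) g(2) by simp
  thus "integrable M (\<lambda>\<omega>. f \<omega> * g \<omega>)"
    "(\<integral>\<omega>. f \<omega> * g \<omega> \<partial>M) = (\<integral>\<omega>. f \<omega> \<partial>M) * (\<integral>\<omega>. g \<omega> \<partial>M)"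
    using f(2) g(2) by (auto intro: indep_var_integrable indep_var_lebesgue_integral)
qed

text \<open>Dynkin's pi-lambda argument for signed integrands: equality of the integrals passes to
  complements, by subtraction from the whole space (hence \<open>space M \<in> E\<close>), and to
  countable disjoint unions.\<close>

lemma integral_indicator_eq_induct:
  fixes f g :: "'a \<Rightarrow> real"
  assumes f: "integrable M f" and g: "integrable M g"
    and E: "Int_stable E" "E \<subseteq> events" "space M \<in> E"
    and eq: "\<And>A. A \<in> E \<Longrightarrow> (\<integral>\<omega>\<in>A. f \<omega> \<partial>M) = (\<integral>\<omega>\<in>A. g \<omega> \<partial>M)"
    and A: "A \<in> sigma_sets (space M) E"
  shows "(\<integral>\<omega>\<in>A. f \<omega> \<partial>M) = (\<integral>\<omega>\<in>A. g \<omega> \<partial>M)"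
  using E(1) subset_trans[OF E(2) sets.space_closed] A
proof (induction rule: sigma_sets_induct_disjoint)
  case (basic A) thus ?case by (rule eq)
next
  case empty show ?case by (simp add: set_lebesgue_integral_def)
next
  case (compl A)
  have "A \<in> events" using compl(1) sets.sigma_sets_subset[OF E(2)] by blast
  have *: "(\<integral>\<omega>\<in>space M - A. h \<omega> \<partial>M) = (\<integral>\<omega>\<in>space M. h \<omega> \<partial>M) - (\<integral>\<omega>\<in>A. h \<omega> \<partial>M)"
    if "integrable M h" for h :: "'a \<Rightarrow> real"
  proof -
    have "set_integrable M B h" if "B \<in> events" for B
      using \<open>integrable M h\<close> that unfolding set_integrable_def by (rule integrable_mult_indicator[rotated])
    hence "(\<integral>\<omega>\<in>A \<union> (space M - A). h \<omega> \<partial>M) = (\<integral>\<omega>\<in>A. h \<omega> \<partial>M) + (\<integral>\<omega>\<in>space M - A. h \<omega> \<partial>M)"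
      using \<open>A \<in> events\<close> by (intro set_integral_Un) auto
    moreover have "A \<union> (space M - A) = space M" using sets.sets_into_space[OF \<open>A \<in> events\<close>] by blast
    ultimately show ?thesis by simp
  qed
  show ?case using compl eq[OF E(3)] by (simp add: *[OF f] *[OF g])
next
  case (union A)
  have A: "A i \<in> events" for i using union(2) sets.sigma_sets_subset[OF E(2)] by blast
  have *: "(\<integral>\<omega>\<in>(\<Union>i. A i). h \<omega> \<partial>M) = (\<Sum>i. \<integral>\<omega>\<in>A i. h \<omega> \<partial>M)" if "integrable M h" for h :: "'a \<Rightarrow> real"
  proof (rule lebesgue_integral_countable_add)
    show "set_integrable M (\<Union>i. A i) h"
      using \<open>integrable M h\<close> A unfolding set_integrable_def by (intro integrable_mult_indicator) auto
  qed (use A union(1) in \<open>auto simp: disjoint_family_on_def\<close>)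
  show ?case using union(3) by (simp add: *[OF f] *[OF g])
qed

text \<open>Independent information does not change a conditional expectation. By the characterising
  property it suffices to compare integrals over the sets C \<inter> D with C from block
  \<open>G\<close> and D from block \<open>J\<close>; over such a set, both integrals are the
  integral over C times the probability of D.\<close>

lemma real_cond_exp_indep_extension:
  fixes Z :: "'i \<Rightarrow> 'a \<Rightarrow> 'b::topological_space" and Y :: "'a \<Rightarrow> real"
  assumes indep: "indep_vars (\<lambda>_. borel) Z UNIV" "I \<inter> J = {}" and IG: "G \<subseteq> I"
    and Y: "Y \<in> borel_measurable (generated_sigma M (Z ` I))" "integrable M Y"
  shows "AE \<omega> in M. real_cond_exp M (generated_sigma M (Z ` (G \<union> J))) Y \<omega>
    = real_cond_exp M (generated_sigma M (Z ` G)) Y \<omega>"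
proof -
  let ?F = "\<lambda>L. generated_sigma M (Z ` L)"
  let ?g = "real_cond_exp M (?F G) Y"
  have Z: "Z ` L \<subseteq> borel_measurable M" for L
    using indep(1) by (auto simp: indep_vars_def2)
  have events: "sets (?F L) \<subseteq> events" for L
    using subalgebra_generated_sigma[OF Z] by (auto simp: subalgebra_def)
  interpret G: finite_measure_subalgebra M "?F G"
    by (rule finite_measure_subalgebra_generated_sigma[OF Z])
  interpret GJ: finite_measure_subalgebra M "?F (G \<union> J)"
    by (rule finite_measure_subalgebra_generated_sigma[OF Z])
  have g: "integrable M ?g" "?g \<in> borel_measurable (?F G)"
    using Y(2) by auto
  \<comment> \<open>A generator of the joint sigma-algebra that is stable under
    intersection.\<close>
  define E where "E = {C \<inter> D | C D. C \<in> sets (?F G) \<and> D \<in> sets (?F J)}"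
  have sets_eq: "sets (?F (G \<union> J)) = sigma_sets (space M) E"
  proof
    have "space M \<in> sets (?F L)" for L using sets.top[of "?F L"] by simp
    hence "C \<inter> space M \<in> E" "space M \<inter> D \<in> E"
      if "C \<in> sets (?F G)" "D \<in> sets (?F J)" for C D
      using that unfolding E_def by blast+
    hence "C \<in> E" if "C \<in> sets (?F G) \<or> C \<in> sets (?F J)" for C
      using that sets.sets_into_space[of C "?F G"] sets.sets_into_space[of C "?F J"]
        sets.empty_sets[of "?F G"] sets.empty_sets[of "?F J"]
      by (metis inf.absorb1 inf.absorb2 space_generated_sigma)
    moreover have "Z i -` S \<inter> space M \<in> sets (?F G) \<or> Z i -` S \<inter> space M \<in> sets (?F J)"
      if "i \<in> G \<union> J" "S \<in> sets borel" for i S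
      using that by (auto simp: sets_generated_sigma)
    ultimately show "sets (?F (G \<union> J)) \<subseteq> sigma_sets (space M) E"
      unfolding sets_generated_sigma[of M "Z ` (G \<union> J)"] by (intro sigma_sets_mono) auto
    have "sets (?F G) \<subseteq> sets (?F (G \<union> J))" "sets (?F J) \<subseteq> sets (?F (G \<union> J))"
      by (auto intro!: sets_generated_sigma_mono)
    thus "sigma_sets (space M) E \<subseteq> sets (?F (G \<union> J))"
      using sets.sigma_sets_subset[of E "?F (G \<union> J)"] unfolding E_def by auto
  qed
  show ?thesis
  proof (rule GJ.real_cond_exp_charact)
    show "(\<integral>\<omega>\<in>A. Y \<omega> \<partial>M) = (\<integral>\<omega>\<in>A. ?g \<omega> \<partial>M)" if "A \<in> sets (?F (G \<union> J))" for A
    proof (rule integral_indicator_eq_induct[OF Y(2) g(1) _ _ _ _ that[unfolded sets_eq]])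
      show "Int_stable E"
      proof (rule Int_stableI)
        fix A B assume "A \<in> E" "B \<in> E"
        then obtain C D C' D' where "A = C \<inter> D" "B = C' \<inter> D'" "C \<in> sets (?F G)" "C' \<in> sets (?F G)"
          "D \<in> sets (?F J)" "D' \<in> sets (?F J)" unfolding E_def by blast
        thus "A \<inter> B \<in> E" unfolding E_def
          by (intro CollectI exI[of _ "C \<inter> C'"] exI[of _ "D \<inter> D'"]) auto
      qed
      show "E \<subseteq> events" using events unfolding E_def by blast
      show "space M \<in> E" using sets.top[of "?F G"] sets.top[of "?F J"] unfolding E_def by force
      fix A assume "A \<in> E"
      then obtain C D where A: "A = C \<inter> D" and C: "C \<in> sets (?F G)" and D: "D \<in> sets (?F J)"
        unfolding E_def by blast
      have CI: "C \<in> sets (?F I)" using C sets_generated_sigma_mono[of "Z ` G" "Z ` I" M] IG by blast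
      \<comment> \<open>Applied both to \<open>Y\<close> and to its conditional expectation; the
        latter is measurable for block \<open>I\<close> because \<open>G\<close> is contained in
        \<open>I\<close>.\<close>
      have split: "(\<integral>\<omega>\<in>A. h \<omega> \<partial>M) = (\<integral>\<omega>\<in>C. h \<omega> \<partial>M) * prob D"
        if h: "h \<in> borel_measurable (?F I)" "integrable M h" for h :: "'a \<Rightarrow> real"
      proof -
        have "(\<integral>\<omega>\<in>A. h \<omega> \<partial>M) = (\<integral>\<omega>. (indicator C \<omega> * h \<omega>) * indicator D \<omega> \<partial>M)"
          unfolding set_lebesgue_integral_def A by (simp add: indicator_inter_arith mult_ac)
        also have "\<dots> = (\<integral>\<omega>. indicator C \<omega> * h \<omega> \<partial>M) * (\<integral>\<omega>. indicator D \<omega> \<partial>M)"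
        proof (rule integral_mult_indep[OF indep])
          show "(\<lambda>\<omega>. indicator C \<omega> * h \<omega>) \<in> borel_measurable (?F I)" using CI h by simp
          show "integrable M (\<lambda>\<omega>. indicator C \<omega> * h \<omega>)"
            using integrable_mult_indicator[OF _ h(2), of C] C events by auto
          show "indicator D \<in> borel_measurable (?F J)" using D by simp
          show "integrable M (indicator D :: 'a \<Rightarrow> real)"
            using D events[of J] by (auto simp: less_top[symmetric])
        qed
        also have "(\<integral>\<omega>. indicator D \<omega> \<partial>M) = prob D"
          using D events[of J] by (subst Bochner_Integration.integral_indicator) (auto simp: Int_absorb2 sets.sets_into_space)
        finally show ?thesis by (simp add: set_lebesgue_integral_def)
      qed
      have gI: "?g \<in> borel_measurable (?F I)"
        by (rule measurable_generated_sigma_mono[OF image_mono[OF IG] g(2)])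
      show "(\<integral>\<omega>\<in>A. Y \<omega> \<partial>M) = (\<integral>\<omega>\<in>A. ?g \<omega> \<partial>M)"
        unfolding split[OF Y] split[OF gI g(1)] by (rule arg_cong[OF G.real_cond_exp_intA[OF Y(2) C]])
    qed
    show "?g \<in> borel_measurable (?F (G \<union> J))"
      by (rule measurable_generated_sigma_mono[OF image_mono[OF Un_upper1] g(2)])
  qed (rule Y(2) g(1))+
qed

lemma vec_cond_exp_indep_extension:
  fixes Z :: "'i \<Rightarrow> 'a \<Rightarrow> 'b::topological_space" and Y :: "'a \<Rightarrow> real ^ 'n"
  assumes indep: "indep_vars (\<lambda>_. borel) Z UNIV" "I \<inter> J = {}" and "G \<subseteq> I"
    and Y: "Y \<in> borel_measurable (generated_sigma M (Z ` I))" "square_integrable M Y"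
  shows "AE \<omega> in M. vec_cond_exp M (generated_sigma M (Z ` (G \<union> J))) Y \<omega>
    = vec_cond_exp M (generated_sigma M (Z ` G)) Y \<omega>"
proof -
  have Z: "Z ` L \<subseteq> borel_measurable M" for L
    using indep(1) by (auto simp: indep_vars_def2)
  interpret GJ: finite_measure_subalgebra M "generated_sigma M (Z ` (G \<union> J))"
    by (rule finite_measure_subalgebra_generated_sigma[OF Z])
  show ?thesis
  proof (rule GJ.vec_cond_exp_eqI)
    fix i
    have "(\<lambda>\<omega>. Y \<omega> $ i) \<in> borel_measurable (generated_sigma M (Z ` I))"
      using Y(1) by (simp add: cart_eq_inner_axis)
    thus "AE \<omega> in M. real_cond_exp M (generated_sigma M (Z ` (G \<union> J))) (\<lambda>\<omega>. Y \<omega> $ i) \<omega>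
        = vec_cond_exp M (generated_sigma M (Z ` G)) Y \<omega> $ i"
      unfolding vec_cond_exp_def vec_lambda_beta
      by (intro real_cond_exp_indep_extension[OF indep assms(3)] GJ.integrable_component Y(2))
  qed
qed

lemma integral_component_eq_0:
  fixes e :: "'a \<Rightarrow> real ^ 'n"
  assumes "square_integrable M e" "(\<integral>\<omega>. e \<omega> \<partial>M) = 0"
  shows "(\<integral>\<omega>. e \<omega> $ k \<partial>M) = 0"
  using integral_bounded_linear[OF bounded_linear_vec_nth square_integrable_imp_integrable[OF assms(1)], of k]
  by (simp add: assms(2))

text \<open>Over any set of the conditioning sigma-algebra the integral factors, and one factor is
  the mean, which is 0.\<close>

lemma vec_cond_exp_indep_centered:
  fixes Z :: "'i \<Rightarrow> 'a \<Rightarrow> real ^ 'n"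
  assumes indep: "indep_vars (\<lambda>_. borel) Z UNIV" "j \<notin> J"
    and Z: "square_integrable M (Z j)" "(\<integral>\<omega>. Z j \<omega> \<partial>M) = 0"
  shows "AE \<omega> in M. vec_cond_exp M (generated_sigma M (Z ` J)) (Z j) \<omega> = 0"
proof -
  have ZL: "Z ` L \<subseteq> borel_measurable M" for L
    using indep(1) by (auto simp: indep_vars_def2)
  interpret J: finite_measure_subalgebra M "generated_sigma M (Z ` J)"
    by (rule finite_measure_subalgebra_generated_sigma[OF ZL])
  show ?thesis
  proof (rule J.vec_cond_exp_eqI, unfold zero_index, rule J.real_cond_exp_charact)
    fix i A assume A: "A \<in> sets (generated_sigma M (Z ` J))"
    hence "A \<in> events" using J.subalg by (auto simp: subalgebra_def)
    have "(\<integral>\<omega>. indicator A \<omega> * Z j \<omega> $ i \<partial>M) = (\<integral>\<omega>. indicator A \<omega> \<partial>M) * (\<integral>\<omega>. Z j \<omega> $ i \<partial>M)"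
    proof (rule integral_mult_indep[OF indep(1), where I=J and J="{j}"])
      show "(\<lambda>\<omega>. Z j \<omega> $ i) \<in> borel_measurable (generated_sigma M (Z ` {j}))"
        using measurable_generated_sigma[of "Z j" "Z ` {j}" M] by (simp add: cart_eq_inner_axis)
      show "integrable M (indicator A :: 'a \<Rightarrow> real)"
        using \<open>A \<in> events\<close> by (simp add: less_top[symmetric])
    qed (use indep A Z J.integrable_component in auto)
    thus "(\<integral>\<omega>\<in>A. Z j \<omega> $ i \<partial>M) = (\<integral>\<omega>\<in>A. 0 \<partial>M)"
      by (simp add: set_lebesgue_integral_def integral_component_eq_0[OF Z])
  qed (use Z J.integrable_component in auto)
qed

text \<open>In coordinates the bilinear form is a finite combination of products of independent
  variables, each with a centered factor. This supplies the orthogonality assumptions of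
  \<open>lq_system\<close>.\<close>

lemma integral_inner_indep_centered:
  fixes Z :: "'i \<Rightarrow> 'a \<Rightarrow> real ^ 'n" and f :: "'a \<Rightarrow> real ^ 'm"
  assumes indep: "indep_vars (\<lambda>_. borel) Z UNIV" "j \<notin> I"
    and Z: "square_integrable M (Z j)" "(\<integral>\<omega>. Z j \<omega> \<partial>M) = 0"
    and f: "f \<in> borel_measurable (generated_sigma M (Z ` I))" "square_integrable M f"
  shows "(\<integral>\<omega>. f \<omega> \<bullet> (T *v Z j \<omega>) \<partial>M) = 0"
proof -
  have comp: "integrable M (\<lambda>\<omega>. f \<omega> $ i)" "integrable M (\<lambda>\<omega>. Z j \<omega> $ k)" for i k
    by (intro square_integrable_imp_integrable square_integrable_component f Z)+
  have prod: "integrable M (\<lambda>\<omega>. f \<omega> $ i * Z j \<omega> $ k)" "(\<integral>\<omega>. f \<omega> $ i * Z j \<omega> $ k \<partial>M) = 0" for i k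
  proof -
    have *: "I \<inter> {j} = {}" "(\<lambda>\<omega>. f \<omega> $ i) \<in> borel_measurable (generated_sigma M (Z ` I))"
      "(\<lambda>\<omega>. Z j \<omega> $ k) \<in> borel_measurable (generated_sigma M (Z ` {j}))"
      using indep(2) f(1) measurable_generated_sigma[of "Z j" "Z ` {j}" M] by (simp_all add: cart_eq_inner_axis)
    show "integrable M (\<lambda>\<omega>. f \<omega> $ i * Z j \<omega> $ k)"
      by (rule integrable_mult_indep[OF indep(1) *(1) *(2) comp(1) *(3) comp(2)])
    show "(\<integral>\<omega>. f \<omega> $ i * Z j \<omega> $ k \<partial>M) = 0"
      using integral_mult_indep[OF indep(1) *(1) *(2) comp(1) *(3) comp(2)]
      by (simp add: integral_component_eq_0[OF Z])
  qed
  have "(\<integral>\<omega>. f \<omega> \<bullet> (T *v Z j \<omega>) \<partial>M) = (\<integral>\<omega>. (\<Sum>i\<in>UNIV. \<Sum>k\<in>UNIV. T $ i $ k * (f \<omega> $ i * Z j \<omega> $ k)) \<partial>M)"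
    by (simp add: inner_vec_def matrix_vector_component sum_distrib_left mult_ac)
  also have "\<dots> = 0" by (simp add: prod)
  finally show ?thesis .
qed

end

section \<open>The controlled state\<close>

text \<open>With z = (X / s)^2, the inequality z \<le> exp z bounds X^2 by s^2 exp ((X /
  s)^2).\<close>

lemma subgaussian_imp_square_integrable:
  assumes "subgaussian M X"
  shows "square_integrable M X"
proof -
  from assms obtain s where X [measurable]: "X \<in> borel_measurable M" and s: "s > 0"
    and le: "(\<integral>\<^sup>+ \<omega>. ennreal (exp ((X \<omega> / s)\<^sup>2)) \<partial>M) \<le> 2"
    unfolding subgaussian_def by blast
  have "integrable M (\<lambda>\<omega>. exp ((X \<omega> / s)\<^sup>2))"
    by (rule integrableI_bounded) (use le in \<open>auto simp: less_top[symmetric] top_unique\<close>)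
  hence "integrable M (\<lambda>\<omega>. s\<^sup>2 * exp ((X \<omega> / s)\<^sup>2))" by simp
  hence "integrable M (\<lambda>\<omega>. (X \<omega>)\<^sup>2)"
  proof (rule Bochner_Integration.integrable_bound)
    have "(X \<omega>)\<^sup>2 \<le> s\<^sup>2 * exp ((X \<omega> / s)\<^sup>2)" for \<omega>
    proof -
      have "(X \<omega>)\<^sup>2 = s\<^sup>2 * (X \<omega> / s)\<^sup>2" using s by (simp add: power_divide)
      also have "\<dots> \<le> s\<^sup>2 * exp ((X \<omega> / s)\<^sup>2)"
        using exp_ge_add_one_self[of "(X \<omega> / s)\<^sup>2"] zero_le_power2[of s] by (intro mult_left_mono) linarith+
      finally show ?thesis .
    qed
    thus "AE \<omega> in M. norm ((X \<omega>)\<^sup>2) \<le> norm (s\<^sup>2 * exp ((X \<omega> / s)\<^sup>2))" by simp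
  qed measurable
  thus ?thesis by (simp add: square_integrable_def)
qed

lemma subgaussian_vec_imp_square_integrable:
  assumes "subgaussian_vec M X"
  shows "square_integrable M X"
proof (rule square_integrable_vecI)
  fix i
  have "subgaussian M (\<lambda>\<omega>. axis i 1 \<bullet> X \<omega>)" using assms by (simp add: subgaussian_vec_def)
  thus "square_integrable M (\<lambda>\<omega>. X \<omega> $ i)"
    by (intro subgaussian_imp_square_integrable) (simp add: inner_axis')
qed

text \<open>Both sequences form a single independent family over \<open>nat + nat\<close>, with
  \<open>Inl\<close> for idiosyncratic and \<open>Inr\<close> for common indices. Centering and
  equal laws are imposed from index 1 on, since index 0 carries the initial perturbations.\<close>

locale common_noise = prob_space M
  for M :: "'a measure" +
  fixes eps eps0 :: "nat \<Rightarrow> 'a \<Rightarrow> real ^ 'd"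
  assumes eps: "\<And>t. square_integrable M (eps t)" and eps0: "\<And>t. square_integrable M (eps0 t)"
    and indep: "indep_vars (\<lambda>_. borel) (case_sum eps eps0) UNIV"
    and eps_centered: "\<And>t. (\<integral>\<omega>. eps (Suc t) \<omega> \<partial>M) = 0"
    and eps0_centered: "\<And>t. (\<integral>\<omega>. eps0 (Suc t) \<omega> \<partial>M) = 0"
    and eps_distr: "\<And>t. distr M borel (eps (Suc t)) = distr M borel (eps (Suc 0))"
    and eps0_distr: "\<And>t. distr M borel (eps0 (Suc t)) = distr M borel (eps0 (Suc 0))"
begin

text \<open>The filtrations are rewritten as blocks of the joint family, the form in which the
  independence lemmas apply.\<close>

lemma common_filtration_eq:
  "common_filtration M eps0 t = generated_sigma M (case_sum eps eps0 ` Inr ` {..t})"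
  by (simp add: common_filtration_def image_image)

lemma full_filtration_eq:
  "full_filtration M eps eps0 t = generated_sigma M (case_sum eps eps0 ` (Inl ` {..t} \<union> Inr ` {..t}))"
  by (simp add: full_filtration_def image_image image_Un)

lemma noise_measurable: "range (case_sum eps eps0) \<subseteq> borel_measurable M"
  using eps eps0 by (auto simp: square_integrable_def split: sum.split)

sublocale common: finite_measure_subalgebra M "common_filtration M eps0 t" for t
  unfolding common_filtration_eq
  by (rule finite_measure_subalgebra_generated_sigma) (use noise_measurable in blast)

lemma measurable_common_full:
  "f \<in> measurable (common_filtration M eps0 t) N \<Longrightarrow> f \<in> measurable (full_filtration M eps eps0 t) N"
  unfolding common_filtration_def full_filtration_def
  by (erule measurable_generated_sigma_mono[rotated]) auto

lemma measurable_common_Suc: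
  "f \<in> measurable (common_filtration M eps0 t) N \<Longrightarrow> f \<in> measurable (common_filtration M eps0 (Suc t)) N"
  unfolding common_filtration_def by (erule measurable_generated_sigma_mono[rotated]) auto

lemma measurable_full_Suc:
  "f \<in> measurable (full_filtration M eps eps0 t) N \<Longrightarrow> f \<in> measurable (full_filtration M eps eps0 (Suc t)) N"
  unfolding full_filtration_def by (erule measurable_generated_sigma_mono[rotated]) auto

lemma eps_full: "eps t \<in> borel_measurable (full_filtration M eps eps0 t)"
  and eps0_full: "eps0 t \<in> borel_measurable (full_filtration M eps eps0 t)"
  and eps0_common: "eps0 t \<in> borel_measurable (common_filtration M eps0 t)"
  unfolding full_filtration_def common_filtration_def by (auto intro: measurable_generated_sigma)

lemma cond_mean_full: "vec_cond_exp M (common_filtration M eps0 t) Y \<in> borel_measurable (full_filtration M eps eps0 t)"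
  by (intro measurable_common_full common.measurable_vec_cond_exp_subalgebra)

lemma cond_mean_cong:
  assumes "AE \<omega> in M. f t \<omega> = g t \<omega>" "square_integrable M (f t)" "square_integrable M (g t)"
  shows "AE \<omega> in M. cond_mean M eps0 f t \<omega> = cond_mean M eps0 g t \<omega>"
  unfolding cond_mean_def using assms
  by (intro common.vec_cond_exp_cong square_integrable_measurable)

text \<open>The only new generator, \<open>eps0 (Suc t)\<close>, is independent of F_t, to which
  \<open>Y\<close> belongs. This is what makes the conditional mean at time t + 1 a function of the
  conditional means at time t.\<close>

lemma vec_cond_exp_common_Suc:
  assumes "Y \<in> borel_measurable (full_filtration M eps eps0 t)" "square_integrable M Y"
  shows "AE \<omega> in M. vec_cond_exp M (common_filtration M eps0 (Suc t)) Y \<omega>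
    = vec_cond_exp M (common_filtration M eps0 t) Y \<omega>"
proof -
  have eq: "(Inr ` {..Suc t} :: (nat + nat) set) = Inr ` {..t} \<union> {Inr (Suc t)}"
    by (auto simp: atMost_Suc)
  show ?thesis unfolding common_filtration_eq eq
    by (rule vec_cond_exp_indep_extension[OF indep _ _ assms(1)[unfolded full_filtration_eq] assms(2)]) auto
qed

lemma vec_cond_exp_eps:
  "AE \<omega> in M. vec_cond_exp M (common_filtration M eps0 t) (eps (Suc s)) \<omega> = 0"
  unfolding common_filtration_eq
  using vec_cond_exp_indep_centered[OF indep, of "Inl (Suc s)" "Inr ` {..t}"] eps eps_centered by auto

lemma
  fixes f :: "'a \<Rightarrow> real ^ 'm"
  assumes "f \<in> borel_measurable (full_filtration M eps eps0 t)" "square_integrable M f"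
  shows eps_uncorrelated: "(\<integral>\<omega>. f \<omega> \<bullet> (T *v eps (Suc t) \<omega>) \<partial>M) = 0"
    and eps0_uncorrelated: "(\<integral>\<omega>. f \<omega> \<bullet> (T *v eps0 (Suc t) \<omega>) \<partial>M) = 0"
proof -
  note uncorrelated = integral_inner_indep_centered[OF indep _ _ _ assms(1)[unfolded full_filtration_eq] assms(2)]
  show "(\<integral>\<omega>. f \<omega> \<bullet> (T *v eps (Suc t) \<omega>) \<partial>M) = 0"
    using uncorrelated[of "Inl (Suc t)" T] by (auto simp: image_iff eps eps_centered)
  show "(\<integral>\<omega>. f \<omega> \<bullet> (T *v eps0 (Suc t) \<omega>) \<partial>M) = 0"
    using uncorrelated[of "Inr (Suc t)" T] by (auto simp: image_iff eps0 eps0_centered)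
qed

lemma measurable_matrix_vector:
  fixes T :: "real ^ 'n ^ 'm"
  shows "f \<in> borel_measurable N \<Longrightarrow> (\<lambda>\<omega>. T *v f \<omega>) \<in> borel_measurable N"
  by (intro borel_measurable_continuous_on[where f="(*v) T"] linear_continuous_on
      matrix_vector_mul_bounded_linear)

end

text \<open>Square integrability of the control is asked at each time separately, without discounted
  summability, so that the locale also covers the closed-loop control before its admissibility is
  established.\<close>

locale controlled_state = common_noise M eps eps0
  for M :: "'a measure" and eps eps0 :: "nat \<Rightarrow> 'a \<Rightarrow> real ^ 'd" +
  fixes A Abar :: "real ^ 'd ^ 'd" and B Bbar :: "real ^ 'l ^ 'd" and u :: "nat \<Rightarrow> 'a \<Rightarrow> real ^ 'l"
  assumes u_adapted: "\<And>t. u t \<in> borel_measurable (full_filtration M eps eps0 t)"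
    and u_L2: "\<And>t. square_integrable M (u t)"
begin

abbreviation "X \<equiv> state M A Abar B Bbar eps eps0 u"
abbreviation "Xbar \<equiv> cond_mean M eps0 X"
abbreviation "ubar \<equiv> cond_mean M eps0 u"

lemma ubar_L2: "square_integrable M (ubar t)"
  unfolding cond_mean_def by (intro common.square_integrable_vec_cond_exp u_L2)

lemma X: "X t \<in> borel_measurable (full_filtration M eps eps0 t)" "square_integrable M (X t)"
proof (induction t)
  case 0
  show "X 0 \<in> borel_measurable (full_filtration M eps eps0 0)" "square_integrable M (X 0)"
    unfolding state.simps
    by (intro borel_measurable_add eps_full eps0_full) (intro square_integrable_add eps eps0)
next
  case (Suc t)
  show "X (Suc t) \<in> borel_measurable (full_filtration M eps eps0 (Suc t))"
    unfolding state.simps cond_mean_def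
    by (intro borel_measurable_add eps_full eps0_full measurable_matrix_vector
        measurable_full_Suc[OF Suc.IH(1)] measurable_full_Suc[OF cond_mean_full] measurable_full_Suc[OF u_adapted])
  show "square_integrable M (X (Suc t))"
    unfolding state.simps cond_mean_def
    by (intro square_integrable_add square_integrable_matrix_vector
        common.square_integrable_vec_cond_exp Suc.IH u_L2 eps eps0)
qed

lemma Xbar_L2: "square_integrable M (Xbar t)"
  unfolding cond_mean_def by (intro common.square_integrable_vec_cond_exp X)

text \<open>Each summand of the state equation is conditioned separately: the terms in the state and
  its mean merge into A + Abar, those in the control into B + Bbar, the common noise is already
  measurable, and the idiosyncratic noise averages to 0.\<close>

lemma Xbar_Suc:
  "AE \<omega> in M. Xbar (Suc t) \<omega> = (A + Abar) *v Xbar t \<omega> + (B + Bbar) *v ubar t \<omega> + eps0 (Suc t) \<omega>"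
proof -
  let ?C = "common_filtration M eps0 (Suc t)"
  let ?E = "vec_cond_exp M ?C"
  let ?s1 = "\<lambda>\<omega>. A *v X t \<omega>" and ?s2 = "\<lambda>\<omega>. Abar *v Xbar t \<omega>"
  let ?s3 = "\<lambda>\<omega>. B *v u t \<omega>" and ?s4 = "\<lambda>\<omega>. Bbar *v ubar t \<omega>"
  have XS: "X (Suc t) = (\<lambda>\<omega>. ?s1 \<omega> + ?s2 \<omega> + ?s3 \<omega> + ?s4 \<omega> + eps0 (Suc t) \<omega> + eps (Suc t) \<omega>)"
    by (simp add: cond_mean_def)
  note L2 = square_integrable_add square_integrable_matrix_vector X(2) Xbar_L2 u_L2 ubar_L2 eps eps0
  have meas: "Xbar t \<in> borel_measurable ?C" "ubar t \<in> borel_measurable ?C"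
    unfolding cond_mean_def by (intro measurable_common_Suc common.measurable_vec_cond_exp_subalgebra)+
  have "AE \<omega> in M. ?E (X (Suc t)) \<omega> = ?E (\<lambda>\<omega>. ?s1 \<omega> + ?s2 \<omega> + ?s3 \<omega> + ?s4 \<omega> + eps0 (Suc t) \<omega>) \<omega> + ?E (eps (Suc t)) \<omega>"
    unfolding XS by (intro common.vec_cond_exp_add L2)
  moreover have "AE \<omega> in M. ?E (\<lambda>\<omega>. ?s1 \<omega> + ?s2 \<omega> + ?s3 \<omega> + ?s4 \<omega> + eps0 (Suc t) \<omega>) \<omega>
      = ?E (\<lambda>\<omega>. ?s1 \<omega> + ?s2 \<omega> + ?s3 \<omega> + ?s4 \<omega>) \<omega> + ?E (eps0 (Suc t)) \<omega>"
    by (intro common.vec_cond_exp_add L2)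
  moreover have "AE \<omega> in M. ?E (\<lambda>\<omega>. ?s1 \<omega> + ?s2 \<omega> + ?s3 \<omega> + ?s4 \<omega>) \<omega>
      = ?E (\<lambda>\<omega>. ?s1 \<omega> + ?s2 \<omega> + ?s3 \<omega>) \<omega> + ?E ?s4 \<omega>"
    by (intro common.vec_cond_exp_add L2)
  moreover have "AE \<omega> in M. ?E (\<lambda>\<omega>. ?s1 \<omega> + ?s2 \<omega> + ?s3 \<omega>) \<omega> = ?E (\<lambda>\<omega>. ?s1 \<omega> + ?s2 \<omega>) \<omega> + ?E ?s3 \<omega>"
    by (intro common.vec_cond_exp_add L2)
  moreover have "AE \<omega> in M. ?E (\<lambda>\<omega>. ?s1 \<omega> + ?s2 \<omega>) \<omega> = ?E ?s1 \<omega> + ?E ?s2 \<omega>"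
    by (intro common.vec_cond_exp_add L2)
  moreover have "AE \<omega> in M. ?E ?s1 \<omega> = A *v ?E (X t) \<omega>" "AE \<omega> in M. ?E ?s3 \<omega> = B *v ?E (u t) \<omega>"
    by (intro common.vec_cond_exp_matrix_vector L2)+
  \<comment> \<open>Here the conditioning time drops from \<open>Suc t\<close> to t.\<close>
  moreover have "AE \<omega> in M. ?E (X t) \<omega> = Xbar t \<omega>" "AE \<omega> in M. ?E (u t) \<omega> = ubar t \<omega>"
    unfolding cond_mean_def by (intro vec_cond_exp_common_Suc X u_adapted u_L2)+
  moreover have "AE \<omega> in M. ?E ?s2 \<omega> = ?s2 \<omega>" "AE \<omega> in M. ?E ?s4 \<omega> = ?s4 \<omega>"
    by (intro common.vec_cond_exp_measurable_eq L2 measurable_matrix_vector meas)+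
  moreover have "AE \<omega> in M. ?E (eps0 (Suc t)) \<omega> = eps0 (Suc t) \<omega>"
    by (intro common.vec_cond_exp_measurable_eq eps0 eps0_common)
  moreover have "AE \<omega> in M. ?E (eps (Suc t)) \<omega> = 0"
    by (rule vec_cond_exp_eps)
  ultimately show ?thesis
    unfolding cond_mean_def[of M eps0 X "Suc t"]
    by eventually_elim (simp add: matrix_vector_mult_add_rdistrib)
qed

text \<open>Subtracting \<open>Xbar_Suc\<close> removes the common noise and every term with
  \<open>Abar\<close> or \<open>Bbar\<close>, so the deviation is driven by \<open>A\<close>,
  \<open>B\<close> and the idiosyncratic noise alone.\<close>

lemma deviation_Suc:
  "AE \<omega> in M. X (Suc t) \<omega> - Xbar (Suc t) \<omega>
    = A *v (X t \<omega> - Xbar t \<omega>) + B *v (u t \<omega> - ubar t \<omega>) + eps (Suc t) \<omega>"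
proof -
  have XS: "X (Suc t) \<omega> = A *v X t \<omega> + Abar *v Xbar t \<omega> + B *v u t \<omega> + Bbar *v ubar t \<omega>
      + eps0 (Suc t) \<omega> + eps (Suc t) \<omega>" for \<omega>
    by (simp add: cond_mean_def)
  show ?thesis using Xbar_Suc[of t]
    by eventually_elim (simp del: state.simps add: XS matrix_vector_distribs)
qed

lemma deviation_adapted:
  "(\<lambda>\<omega>. X t \<omega> - Xbar t \<omega>) \<in> borel_measurable (full_filtration M eps eps0 t)"
  "(\<lambda>\<omega>. u t \<omega> - ubar t \<omega>) \<in> borel_measurable (full_filtration M eps eps0 t)"
  unfolding cond_mean_def by (intro borel_measurable_diff X u_adapted cond_mean_full)+

lemma idiosyncratic_system:
  assumes "0 < \<gamma>" "\<gamma> < 1" "\<gamma> * (spectral_norm A)\<^sup>2 < 1"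
    "pos_semidef Q" "symmetric_mat R" "pos_def R" "symmetric_mat S" "pos_semidef S"
    "stationary_gain \<gamma> A B R S K"
    "S = Q + transpose K ** R ** K + \<gamma> *\<^sub>R (transpose (A - B ** K) ** S ** (A - B ** K))"
  shows "lq_system M \<gamma> A Q S B R K (\<lambda>t \<omega>. X t \<omega> - Xbar t \<omega>) eps (\<lambda>t \<omega>. u t \<omega> - ubar t \<omega>)"
proof (intro lq_system.intro lq_system_axioms.intro prob_space_axioms assms)
  have L2: "square_integrable M (\<lambda>\<omega>. X t \<omega> - Xbar t \<omega>)" "square_integrable M (\<lambda>\<omega>. u t \<omega> - ubar t \<omega>)" for t
    by (intro square_integrable_diff X u_L2 ubar_L2 Xbar_L2)+
  show "square_integrable M (\<lambda>\<omega>. X 0 \<omega> - Xbar 0 \<omega>)" by (rule L2)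
  fix t
  show "(\<lambda>\<omega>. X t \<omega> - Xbar t \<omega>) \<in> borel_measurable M"
    by (rule square_integrable_measurable[OF L2(1)])
  show "square_integrable M (\<lambda>\<omega>. u t \<omega> - ubar t \<omega>)" by (rule L2)
  show "(\<integral>\<omega>. (X t \<omega> - Xbar t \<omega>) \<bullet> (T *v eps (Suc t) \<omega>) \<partial>M) = 0" for T
    by (rule eps_uncorrelated[OF deviation_adapted(1) L2(1)])
  show "(\<integral>\<omega>. (u t \<omega> - ubar t \<omega>) \<bullet> (T *v eps (Suc t) \<omega>) \<partial>M) = 0" for T
    by (rule eps_uncorrelated[OF deviation_adapted(2) L2(2)])
qed (rule eps eps_distr deviation_Suc)+

lemma common_system:
  assumes "0 < \<gamma>" "\<gamma> < 1" "\<gamma> * (spectral_norm (A + Abar))\<^sup>2 < 1"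
    "pos_semidef Q" "symmetric_mat R" "pos_def R" "symmetric_mat S" "pos_semidef S"
    "stationary_gain \<gamma> (A + Abar) (B + Bbar) R S K"
    "S = Q + transpose K ** R ** K
       + \<gamma> *\<^sub>R (transpose (A + Abar - (B + Bbar) ** K) ** S ** (A + Abar - (B + Bbar) ** K))"
  shows "lq_system M \<gamma> (A + Abar) Q S (B + Bbar) R K Xbar eps0 ubar"
proof (intro lq_system.intro lq_system_axioms.intro prob_space_axioms assms Xbar_L2 ubar_L2)
  fix t
  show "Xbar t \<in> borel_measurable M"
    by (rule square_integrable_measurable[OF Xbar_L2])
  have "Xbar t \<in> borel_measurable (full_filtration M eps eps0 t)"
    "ubar t \<in> borel_measurable (full_filtration M eps eps0 t)"
    unfolding cond_mean_def by (rule cond_mean_full)+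
  thus "(\<integral>\<omega>. Xbar t \<omega> \<bullet> (T *v eps0 (Suc t) \<omega>) \<partial>M) = 0"
    "(\<integral>\<omega>. ubar t \<omega> \<bullet> (T' *v eps0 (Suc t) \<omega>) \<partial>M) = 0" for T T'
    by (auto intro: eps0_uncorrelated Xbar_L2 ubar_L2)
qed (rule eps0 eps0_distr Xbar_Suc)+

text \<open>The deviation has conditional mean 0, so conditioning the feedback law leaves the law of
  the mean control; subtracting it leaves the law of the deviation. The single law is thereby
  matched with the two zero-gap conditions.\<close>

lemma feedback_iff:
  "(\<forall>t. AE \<omega> in M. u t \<omega> = - (K *v (X t \<omega> - Xbar t \<omega>)) - L *v Xbar t \<omega>) \<longleftrightarrow>
   (\<forall>t. AE \<omega> in M. u t \<omega> - ubar t \<omega> = - (K *v (X t \<omega> - Xbar t \<omega>))) \<and>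
   (\<forall>t. AE \<omega> in M. ubar t \<omega> = - (L *v Xbar t \<omega>))"
proof (intro iffI)
  assume fb: "\<forall>t. AE \<omega> in M. u t \<omega> = - (K *v (X t \<omega> - Xbar t \<omega>)) - L *v Xbar t \<omega>"
  have ubar: "AE \<omega> in M. ubar t \<omega> = - (L *v Xbar t \<omega>)" for t
  proof -
    let ?E = "vec_cond_exp M (common_filtration M eps0 t)"
    \<comment> \<open>Regrouped by \<open>X\<close> and \<open>Xbar\<close> so that linearity
      applies; conditioning gives - K Xbar + (K - L) Xbar = - L Xbar.\<close>
    let ?f = "\<lambda>\<omega>. (- K) *v X t \<omega> + (K - L) *v Xbar t \<omega>"
    note L2 = square_integrable_add square_integrable_matrix_vector X(2) Xbar_L2
    have "AE \<omega> in M. u t \<omega> = ?f \<omega>"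
      using fb[rule_format, of t]
      by eventually_elim (simp add: matrix_vector_distribs)
    hence "AE \<omega> in M. ?E (u t) \<omega> = ?E ?f \<omega>"
      by (intro common.vec_cond_exp_cong square_integrable_measurable u_L2 L2)
    moreover have "AE \<omega> in M. ?E ?f \<omega> = ?E (\<lambda>\<omega>. (- K) *v X t \<omega>) \<omega> + ?E (\<lambda>\<omega>. (K - L) *v Xbar t \<omega>) \<omega>"
      by (intro common.vec_cond_exp_add L2)
    moreover have "AE \<omega> in M. ?E (\<lambda>\<omega>. (- K) *v X t \<omega>) \<omega> = (- K) *v ?E (X t) \<omega>"
      by (intro common.vec_cond_exp_matrix_vector L2)
    moreover have "AE \<omega> in M. ?E (\<lambda>\<omega>. (K - L) *v Xbar t \<omega>) \<omega> = (K - L) *v Xbar t \<omega>"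
      by (intro common.vec_cond_exp_measurable_eq L2 measurable_matrix_vector)
        (simp add: cond_mean_def common.measurable_vec_cond_exp_subalgebra)
    ultimately show ?thesis unfolding cond_mean_def
      by eventually_elim (simp add: matrix_vector_distribs)
  qed
  moreover have "AE \<omega> in M. u t \<omega> - ubar t \<omega> = - (K *v (X t \<omega> - Xbar t \<omega>))" for t
    using fb[rule_format, of t] ubar[of t] by eventually_elim simp
  ultimately show "(\<forall>t. AE \<omega> in M. u t \<omega> - ubar t \<omega> = - (K *v (X t \<omega> - Xbar t \<omega>))) \<and>
   (\<forall>t. AE \<omega> in M. ubar t \<omega> = - (L *v Xbar t \<omega>))" by blast
next
  assume *: "(\<forall>t. AE \<omega> in M. u t \<omega> - ubar t \<omega> = - (K *v (X t \<omega> - Xbar t \<omega>))) \<and>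
   (\<forall>t. AE \<omega> in M. ubar t \<omega> = - (L *v Xbar t \<omega>))"
  show "\<forall>t. AE \<omega> in M. u t \<omega> = - (K *v (X t \<omega> - Xbar t \<omega>)) - L *v Xbar t \<omega>"
  proof
    fix t
    show "AE \<omega> in M. u t \<omega> = - (K *v (X t \<omega> - Xbar t \<omega>)) - L *v Xbar t \<omega>"
      using *[THEN conjunct1, rule_format, of t] *[THEN conjunct2, rule_format, of t]
      by eventually_elim (metis diff_conv_add_uminus diff_add_cancel)
  qed
qed

lemma ubar_norm_le: "(\<integral>\<omega>. (norm (ubar t \<omega>))\<^sup>2 \<partial>M) \<le> (\<integral>\<omega>. (norm (u t \<omega>))\<^sup>2 \<partial>M)"
  unfolding cond_mean_def by (rule common.norm_vec_cond_exp_le[OF u_L2])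

end

section \<open>Optimality of the feedback control\<close>

lemma (in prob_space) nn_integral_discounted_sum:
  fixes f :: "nat \<Rightarrow> 'a \<Rightarrow> real"
  assumes "0 < \<gamma>" "\<And>t \<omega>. 0 \<le> f t \<omega>" "\<And>t. integrable M (f t)"
  shows "(\<integral>\<^sup>+ \<omega>. (\<Sum>t. ennreal (\<gamma> ^ t * f t \<omega>)) \<partial>M) = (\<Sum>t. ennreal (\<gamma> ^ t * (\<integral>\<omega>. f t \<omega> \<partial>M)))"
proof -
  have "(\<integral>\<^sup>+ \<omega>. (\<Sum>t. ennreal (\<gamma> ^ t * f t \<omega>)) \<partial>M) = (\<Sum>t. \<integral>\<^sup>+ \<omega>. ennreal (\<gamma> ^ t * f t \<omega>) \<partial>M)"
    using borel_measurable_integrable[OF assms(3)] by (intro nn_integral_suminf) measurable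
  also have "\<dots> = (\<Sum>t. ennreal (\<gamma> ^ t * (\<integral>\<omega>. f t \<omega> \<partial>M)))"
    using assms by (subst nn_integral_eq_integral) auto
  finally show ?thesis .
qed

text \<open>Bridge from extended to real values: a single term lies below the series, so finiteness
  makes every term integrable, and then Tonelli identifies the two sums.\<close>

lemma (in prob_space) nn_integral_discounted_finite_iff:
  fixes f :: "nat \<Rightarrow> 'a \<Rightarrow> real"
  assumes \<gamma>: "0 < \<gamma>" and f: "\<And>t \<omega>. 0 \<le> f t \<omega>" "\<And>t. f t \<in> borel_measurable M"
  shows "(\<integral>\<^sup>+ \<omega>. (\<Sum>t. ennreal (\<gamma> ^ t * f t \<omega>)) \<partial>M) < \<infinity> \<longleftrightarrow>
    (\<forall>t. integrable M (f t)) \<and> summable (\<lambda>t. \<gamma> ^ t * (\<integral>\<omega>. f t \<omega> \<partial>M))"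
proof (intro iffI conjI)
  assume fin: "(\<integral>\<^sup>+ \<omega>. (\<Sum>t. ennreal (\<gamma> ^ t * f t \<omega>)) \<partial>M) < \<infinity>"
  show int: "\<forall>t. integrable M (f t)"
  proof
    fix t
    have "(\<integral>\<^sup>+ \<omega>. ennreal (\<gamma> ^ t * f t \<omega>) \<partial>M) \<le> (\<integral>\<^sup>+ \<omega>. (\<Sum>t. ennreal (\<gamma> ^ t * f t \<omega>)) \<partial>M)"
    proof (rule nn_integral_mono)
      fix \<omega>
      show "ennreal (\<gamma> ^ t * f t \<omega>) \<le> (\<Sum>t. ennreal (\<gamma> ^ t * f t \<omega>))"
        using sum_le_suminf[of "\<lambda>t. ennreal (\<gamma> ^ t * f t \<omega>)" "{t}"] by simp
    qed
    hence "(\<integral>\<^sup>+ \<omega>. ennreal (\<gamma> ^ t * f t \<omega>) \<partial>M) < \<infinity>" using fin by (rule le_less_trans)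
    hence "integrable M (\<lambda>\<omega>. \<gamma> ^ t * f t \<omega>)"
      using \<gamma> f by (intro integrableI_nonneg) auto
    hence "integrable M (\<lambda>\<omega>. (1 / \<gamma> ^ t) * (\<gamma> ^ t * f t \<omega>))" by (rule integrable_mult_right)
    thus "integrable M (f t)" using \<gamma> by simp
  qed
  show "summable (\<lambda>t. \<gamma> ^ t * (\<integral>\<omega>. f t \<omega> \<partial>M))"
  proof (rule summable_suminf_not_top)
    show "0 \<le> \<gamma> ^ t * (\<integral>\<omega>. f t \<omega> \<partial>M)" for t
      using \<gamma> f by simp
    show "(\<Sum>t. ennreal (\<gamma> ^ t * (\<integral>\<omega>. f t \<omega> \<partial>M))) \<noteq> top"
      using fin int by (simp add: nn_integral_discounted_sum[OF \<gamma> f(1)])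
  qed
next
  assume "(\<forall>t. integrable M (f t)) \<and> summable (\<lambda>t. \<gamma> ^ t * (\<integral>\<omega>. f t \<omega> \<partial>M))"
  thus "(\<integral>\<^sup>+ \<omega>. (\<Sum>t. ennreal (\<gamma> ^ t * f t \<omega>)) \<partial>M) < \<infinity>"
    using \<gamma> f by (simp add: nn_integral_discounted_sum suminf_ennreal2)
qed

lemma (in common_noise) admissible_iff:
  assumes "0 < \<gamma>"
  shows "u \<in> admissible M \<gamma> eps eps0 \<longleftrightarrow>
    (\<forall>t. u t \<in> borel_measurable (full_filtration M eps eps0 t)) \<and> (\<forall>t. square_integrable M (u t)) \<and>
    summable (\<lambda>t. \<gamma> ^ t * (\<integral>\<omega>. (norm (u t \<omega>))\<^sup>2 \<partial>M))"
proof -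
  have sub: "subalgebra M (full_filtration M eps eps0 t)" for t
    unfolding full_filtration_eq by (rule subalgebra_generated_sigma) (use noise_measurable in blast)
  have meas: "u t \<in> borel_measurable M" if "u t \<in> borel_measurable (full_filtration M eps eps0 t)" for t
    by (rule measurable_from_subalg[OF sub that])
  show ?thesis
  proof (cases "\<forall>t. u t \<in> borel_measurable (full_filtration M eps eps0 t)")
    case True
    hence M: "u t \<in> borel_measurable M" for t using meas by blast
    hence "(\<lambda>\<omega>. (norm (u t \<omega>))\<^sup>2) \<in> borel_measurable M" for t by measurable
    from nn_integral_discounted_finite_iff[OF assms _ this] show ?thesis
      using True M unfolding admissible_def square_integrable_def by simp
  next
    case False
    thus ?thesis unfolding admissible_def by blast
  qed
qed

text \<open>The value matrices and gains are parameters subject to their equations, so the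
  optimality argument is independent of how a fixed point was found.\<close>

locale mean_field_lq = common_noise M eps eps0
  for M :: "'a measure" and eps eps0 :: "nat \<Rightarrow> 'a \<Rightarrow> real ^ 'd" +
  fixes \<gamma> :: real and A Abar Q Qbar S Sbar :: "real ^ 'd ^ 'd" and B Bbar :: "real ^ 'l ^ 'd"
    and R Rbar :: "real ^ 'l ^ 'l" and K L :: "real ^ 'd ^ 'l"
  assumes discount: "0 < \<gamma>" "\<gamma> < 1" "\<gamma> * (spectral_norm A)\<^sup>2 < 1" "\<gamma> * (spectral_norm (A + Abar))\<^sup>2 < 1"
    and idio: "pos_semidef Q" "symmetric_mat R" "pos_def R" "symmetric_mat S" "pos_semidef S"
      "stationary_gain \<gamma> A B R S K"
      "S = Q + transpose K ** R ** K + \<gamma> *\<^sub>R (transpose (A - B ** K) ** S ** (A - B ** K))"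
    and comm: "pos_semidef (Q + Qbar)" "symmetric_mat (R + Rbar)" "pos_def (R + Rbar)"
      "symmetric_mat Sbar" "pos_semidef Sbar" "stationary_gain \<gamma> (A + Abar) (B + Bbar) (R + Rbar) Sbar L"
      "Sbar = Q + Qbar + transpose L ** (R + Rbar) ** L
         + \<gamma> *\<^sub>R (transpose (A + Abar - (B + Bbar) ** L) ** Sbar ** (A + Abar - (B + Bbar) ** L))"
begin

abbreviation "X u \<equiv> state M A Abar B Bbar eps eps0 u"
abbreviation "J u \<equiv> cost M \<gamma> A Abar B Bbar Q Qbar R Rbar eps eps0 u"

text \<open>A condition on \<open>u\<close> rather than a formula for it, since the state on the
  right is itself controlled by \<open>u\<close>.\<close>

definition "feedback u \<longleftrightarrow> (\<forall>t. AE \<omega> in M. u t \<omega>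
  = - (K *v (X u t \<omega> - cond_mean M eps0 (X u) t \<omega>)) - L *v cond_mean M eps0 (X u) t \<omega>)"

text \<open>The two base costs written in terms of the noise only. The state at time 0 is the same
  for all controls, so this constant can be compared across controls.\<close>

definition "least_cost =
  (\<integral>\<omega>. quad S (eps0 0 \<omega> + eps 0 \<omega> - vec_cond_exp M (common_filtration M eps0 0) (\<lambda>\<omega>. eps0 0 \<omega> + eps 0 \<omega>) \<omega>) \<partial>M)
    + \<gamma> / (1 - \<gamma>) * (\<integral>\<omega>. quad S (eps (Suc 0) \<omega>) \<partial>M)
  + ((\<integral>\<omega>. quad Sbar (vec_cond_exp M (common_filtration M eps0 0) (\<lambda>\<omega>. eps0 0 \<omega> + eps 0 \<omega>) \<omega>) \<partial>M)
    + \<gamma> / (1 - \<gamma>) * (\<integral>\<omega>. quad Sbar (eps0 (Suc 0) \<omega>) \<partial>M))"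

lemma least_cost_nonneg: "0 \<le> least_cost"
proof -
  have "0 \<le> (\<integral>\<omega>. quad S (f \<omega>) \<partial>M)" "0 \<le> (\<integral>\<omega>. quad Sbar (f \<omega>) \<partial>M)" for f
    using idio(5) comm(5) by (auto intro!: Bochner_Integration.integral_nonneg simp: pos_semidef_def)
  thus ?thesis unfolding least_cost_def using discount by (intro add_nonneg_nonneg mult_nonneg_nonneg) auto
qed

text \<open>The running cost splits into the stage costs of the two systems, and g is the sum of
  their discounted gap series. All gaps are nonnegative, so g vanishes iff each of them does, that
  is, iff both feedback laws hold.\<close>

lemma cost_decomposition:
  assumes u: "u \<in> admissible M \<gamma> eps eps0"
  shows "\<exists>g\<ge>0. J u = ennreal (least_cost + g) \<and> (g = 0 \<longleftrightarrow> feedback u)"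
proof -
  interpret cs: controlled_state M eps eps0 A Abar B Bbar u
    using u unfolding admissible_iff[OF discount(1)] by unfold_locales auto
  let ?y = "\<lambda>t \<omega>. cs.X t \<omega> - cs.Xbar t \<omega>" and ?v = "\<lambda>t \<omega>. u t \<omega> - cs.ubar t \<omega>"
  interpret Y: lq_system M \<gamma> A Q S B R K ?y eps ?v
    by (rule cs.idiosyncratic_system) (rule discount idio)+
  interpret Z: lq_system M \<gamma> "A + Abar" "Q + Qbar" Sbar "B + Bbar" "R + Rbar" L cs.Xbar eps0 cs.ubar
    by (rule cs.common_system) (rule discount comm)+
  have u_sum: "summable (\<lambda>t. \<gamma> ^ t * (\<integral>\<omega>. (norm (u t \<omega>))\<^sup>2 \<partial>M))"
    using u unfolding admissible_iff[OF discount(1)] by blast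
  have int: "integrable M (\<lambda>\<omega>. (norm (u t \<omega>))\<^sup>2)" "integrable M (\<lambda>\<omega>. (norm (cs.ubar t \<omega>))\<^sup>2)"
    "integrable M (\<lambda>\<omega>. (norm (?v t \<omega>))\<^sup>2)" for t
    using cs.u_L2 cs.ubar_L2 Y.v by (auto simp: square_integrable_def)
  have ubar_sum: "summable (\<lambda>t. \<gamma> ^ t * (\<integral>\<omega>. (norm (cs.ubar t \<omega>))\<^sup>2 \<partial>M))"
    by (rule summable_comparison_test'[OF u_sum, of 0]) (use discount cs.ubar_norm_le in auto)
  have v_sum: "summable (\<lambda>t. \<gamma> ^ t * (\<integral>\<omega>. (norm (?v t \<omega>))\<^sup>2 \<partial>M))"
  proof (rule summable_comparison_test')
    show "summable (\<lambda>t. 2 * (\<gamma> ^ t * (\<integral>\<omega>. (norm (u t \<omega>))\<^sup>2 \<partial>M)) + 2 * (\<gamma> ^ t * (\<integral>\<omega>. (norm (cs.ubar t \<omega>))\<^sup>2 \<partial>M)))"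
      by (intro summable_add summable_mult u_sum ubar_sum)
    fix t
    have "(\<integral>\<omega>. (norm (?v t \<omega>))\<^sup>2 \<partial>M) \<le> (\<integral>\<omega>. 2 * (norm (u t \<omega>))\<^sup>2 + 2 * (norm (cs.ubar t \<omega>))\<^sup>2 \<partial>M)"
    proof (rule integral_mono)
      show "(norm (?v t \<omega>))\<^sup>2 \<le> 2 * (norm (u t \<omega>))\<^sup>2 + 2 * (norm (cs.ubar t \<omega>))\<^sup>2" for \<omega>
        using norm_add_squared_le[of 1 "u t \<omega>" "- cs.ubar t \<omega>"] by simp
    qed (simp_all add: int)
    hence "(\<integral>\<omega>. (norm (?v t \<omega>))\<^sup>2 \<partial>M) \<le> 2 * (\<integral>\<omega>. (norm (u t \<omega>))\<^sup>2 \<partial>M) + 2 * (\<integral>\<omega>. (norm (cs.ubar t \<omega>))\<^sup>2 \<partial>M)"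
      by (simp add: int)
    from mult_left_mono[OF this, of "\<gamma> ^ t"]
    show "norm (\<gamma> ^ t * (\<integral>\<omega>. (norm (?v t \<omega>))\<^sup>2 \<partial>M))
        \<le> 2 * (\<gamma> ^ t * (\<integral>\<omega>. (norm (u t \<omega>))\<^sup>2 \<partial>M)) + 2 * (\<gamma> ^ t * (\<integral>\<omega>. (norm (cs.ubar t \<omega>))\<^sup>2 \<partial>M))"
      using discount by (simp add: algebra_simps)
  qed
  note Yh = Y.infinite_horizon[OF v_sum] and Zh = Z.infinite_horizon[OF ubar_sum]
  let ?rc = "\<lambda>t \<omega>. running_cost Q Qbar R Rbar (cs.X t \<omega>) (cs.Xbar t \<omega>) (u t \<omega>) (cs.ubar t \<omega>)"
  have rc_nonneg: "0 \<le> ?rc t \<omega>" for t \<omega>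
    using idio(1) comm(1) pos_def_imp_semidef[OF idio(3)] pos_def_imp_semidef[OF comm(3)]
    by (auto simp: running_cost_def pos_semidef_def intro!: add_nonneg_nonneg)
  have rc_eq: "?rc t \<omega> = (quad Q (?y t \<omega>) + quad R (?v t \<omega>))
      + (quad (Q + Qbar) (cs.Xbar t \<omega>) + quad (R + Rbar) (cs.ubar t \<omega>))" for t \<omega>
    by (simp add: running_cost_def)
  have rc_int: "integrable M (?rc t)" for t
    unfolding rc_eq by (intro Bochner_Integration.integrable_add integrable_quad Y.y Y.v Z.y Z.v)
  have rc_integral: "(\<integral>\<omega>. ?rc t \<omega> \<partial>M) = Y.stage_cost t + Z.stage_cost t" for t
    unfolding rc_eq Y.stage_cost_def Z.stage_cost_def
    by (intro Bochner_Integration.integral_add Bochner_Integration.integrable_add integrable_quad Y.y Y.v Z.y Z.v)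
  have "J u = (\<integral>\<^sup>+ \<omega>. (\<Sum>t. ennreal (\<gamma> ^ t * ?rc t \<omega>)) \<partial>M)"
    by (simp add: cost_def Let_def)
  also have "\<dots> = (\<Sum>t. ennreal (\<gamma> ^ t * Y.stage_cost t + \<gamma> ^ t * Z.stage_cost t))"
    using nn_integral_discounted_sum[of \<gamma> ?rc, OF discount(1) rc_nonneg rc_int]
    by (simp add: rc_integral distrib_left)
  also have "\<dots> = ennreal (\<Sum>t. \<gamma> ^ t * Y.stage_cost t + \<gamma> ^ t * Z.stage_cost t)"
    using discount Y.stage_cost_nonneg Z.stage_cost_nonneg
    by (intro suminf_ennreal2 summable_add Yh(1) Zh(1)) simp
  also have "(\<Sum>t. \<gamma> ^ t * Y.stage_cost t + \<gamma> ^ t * Z.stage_cost t)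
      = Y.base_cost + Z.base_cost + ((\<Sum>t. \<gamma> ^ t * Y.gap t) + (\<Sum>t. \<gamma> ^ t * Z.gap t))"
    by (simp add: suminf_add[symmetric] Yh Zh)
  also have "Y.base_cost + Z.base_cost = least_cost"
    unfolding Y.base_cost_def Z.base_cost_def
    unfolding least_cost_def cond_mean_def state.simps(1) ..
  finally have J: "J u = ennreal (least_cost + ((\<Sum>t. \<gamma> ^ t * Y.gap t) + (\<Sum>t. \<gamma> ^ t * Z.gap t)))" .
  have nonneg: "0 \<le> \<gamma> ^ t * Y.gap t" "0 \<le> \<gamma> ^ t * Z.gap t" for t
    using discount Y.gap_nonneg Z.gap_nonneg by simp_all
  have "(\<Sum>t. \<gamma> ^ t * Y.gap t) = 0 \<longleftrightarrow> (\<forall>t. Y.gap t = 0)"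
    "(\<Sum>t. \<gamma> ^ t * Z.gap t) = 0 \<longleftrightarrow> (\<forall>t. Z.gap t = 0)"
    using suminf_eq_zero_iff[OF Yh(2) nonneg(1)] suminf_eq_zero_iff[OF Zh(2) nonneg(2)] discount by auto
  hence "(\<Sum>t. \<gamma> ^ t * Y.gap t) + (\<Sum>t. \<gamma> ^ t * Z.gap t) = 0 \<longleftrightarrow> (\<forall>t. Y.gap t = 0) \<and> (\<forall>t. Z.gap t = 0)"
    using suminf_nonneg[OF Yh(2) nonneg(1)] suminf_nonneg[OF Zh(2) nonneg(2)]
    by (simp add: add_nonneg_eq_0_iff)
  also have "\<dots> \<longleftrightarrow> feedback u"
    unfolding Y.gap_eq_0_iff Z.gap_eq_0_iff feedback_def cs.feedback_iff ..
  finally have iff: "(\<Sum>t. \<gamma> ^ t * Y.gap t) + (\<Sum>t. \<gamma> ^ t * Z.gap t) = 0 \<longleftrightarrow> feedback u" .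
  show ?thesis
    using J iff suminf_nonneg[OF Yh(2) nonneg(1)] suminf_nonneg[OF Zh(2) nonneg(2)] add_nonneg_nonneg by blast
qed

section \<open>Construction of the closed-loop control\<close>

definition feedback_law :: "nat \<Rightarrow> ('a \<Rightarrow> real ^ 'd) \<Rightarrow> 'a \<Rightarrow> real ^ 'l" where
  "feedback_law t x = (\<lambda>\<omega>. let xbar = vec_cond_exp M (common_filtration M eps0 t) x \<omega>
     in - (K *v (x \<omega> - xbar)) - L *v xbar)"

text \<open>Breaks the circularity between control and controlled state: the feedback law is
  substituted into the state equation, giving a plain recursion. \<open>state_closed_loop\<close>
  confirms afterwards that this process is the state of the resulting control.\<close>

primrec closed_loop :: "nat \<Rightarrow> 'a \<Rightarrow> real ^ 'd" where
  "closed_loop 0 = (\<lambda>\<omega>. eps0 0 \<omega> + eps 0 \<omega>)"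
| "closed_loop (Suc t) = (\<lambda>\<omega>.
     A *v closed_loop t \<omega> + Abar *v vec_cond_exp M (common_filtration M eps0 t) (closed_loop t) \<omega>
     + B *v feedback_law t (closed_loop t) \<omega>
     + Bbar *v vec_cond_exp M (common_filtration M eps0 t) (feedback_law t (closed_loop t)) \<omega>
     + eps0 (Suc t) \<omega> + eps (Suc t) \<omega>)"

definition "closed_loop_control t = feedback_law t (closed_loop t)"

lemma state_closed_loop: "X closed_loop_control t = closed_loop t"
  by (induction t) (simp_all add: closed_loop_control_def cond_mean_def)

lemma feedback_law_regular:
  assumes "x \<in> borel_measurable (full_filtration M eps eps0 t)" "square_integrable M x"
  shows "feedback_law t x \<in> borel_measurable (full_filtration M eps eps0 t)"
    "square_integrable M (feedback_law t x)"
  unfolding feedback_law_def Let_def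
  by (intro borel_measurable_diff borel_measurable_uminus measurable_matrix_vector cond_mean_full assms)
    (intro square_integrable_diff square_integrable_minus square_integrable_matrix_vector
        common.square_integrable_vec_cond_exp assms)

lemma closed_loop_regular:
  "closed_loop t \<in> borel_measurable (full_filtration M eps eps0 t)" "square_integrable M (closed_loop t)"
proof (induction t)
  case 0
  show "closed_loop 0 \<in> borel_measurable (full_filtration M eps eps0 0)" "square_integrable M (closed_loop 0)"
    unfolding closed_loop.simps
    by (intro borel_measurable_add eps_full eps0_full) (intro square_integrable_add eps eps0)
next
  case (Suc t)
  show "closed_loop (Suc t) \<in> borel_measurable (full_filtration M eps eps0 (Suc t))"
    unfolding closed_loop.simps
    by (intro borel_measurable_add eps_full eps0_full measurable_matrix_vector
        measurable_full_Suc[OF Suc.IH(1)] measurable_full_Suc[OF cond_mean_full]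
        measurable_full_Suc[OF feedback_law_regular(1)] Suc.IH)
  show "square_integrable M (closed_loop (Suc t))"
    unfolding closed_loop.simps
    by (intro square_integrable_add square_integrable_matrix_vector
        common.square_integrable_vec_cond_exp Suc.IH feedback_law_regular eps eps0)
qed

lemma feedback_closed_loop: "feedback closed_loop_control"
  unfolding feedback_def cond_mean_def state_closed_loop
  by (simp add: closed_loop_control_def feedback_law_def Let_def)

text \<open>No stability analysis of the closed loop is needed: with zero gap, the partial sums of the cost
  are bounded by the base cost, and \<open>R\<close> is coercive.\<close>

lemma closed_loop_admissible: "closed_loop_control \<in> admissible M \<gamma> eps eps0"
proof -
  let ?u = closed_loop_control
  interpret cs: controlled_state M eps eps0 A Abar B Bbar ?u
    by unfold_locales
      (simp_all add: closed_loop_control_def feedback_law_regular closed_loop_regular)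
  let ?y = "\<lambda>t \<omega>. cs.X t \<omega> - cs.Xbar t \<omega>" and ?v = "\<lambda>t \<omega>. ?u t \<omega> - cs.ubar t \<omega>"
  interpret Y: lq_system M \<gamma> A Q S B R K ?y eps ?v
    by (rule cs.idiosyncratic_system) (rule discount idio)+
  interpret Z: lq_system M \<gamma> "A + Abar" "Q + Qbar" Sbar "B + Bbar" "R + Rbar" L cs.Xbar eps0 cs.ubar
    by (rule cs.common_system) (rule discount comm)+
  have "\<forall>t. Y.gap t = 0" "\<forall>t. Z.gap t = 0"
    using feedback_closed_loop unfolding feedback_def cs.feedback_iff
    by (simp_all add: Y.gap_eq_0_iff Z.gap_eq_0_iff)
  hence v_sum: "summable (\<lambda>t. \<gamma> ^ t * (\<integral>\<omega>. (norm (?v t \<omega>))\<^sup>2 \<partial>M))"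
    and ubar_sum: "summable (\<lambda>t. \<gamma> ^ t * (\<integral>\<omega>. (norm (cs.ubar t \<omega>))\<^sup>2 \<partial>M))"
    by (simp_all only: Y.summable_of_zero_gap Z.summable_of_zero_gap)
  have int: "integrable M (\<lambda>\<omega>. (norm (?u t \<omega>))\<^sup>2)" "integrable M (\<lambda>\<omega>. (norm (cs.ubar t \<omega>))\<^sup>2)"
    "integrable M (\<lambda>\<omega>. (norm (?v t \<omega>))\<^sup>2)" for t
    using cs.u_L2 cs.ubar_L2 Y.v by (auto simp: square_integrable_def)
  have "summable (\<lambda>t. \<gamma> ^ t * (\<integral>\<omega>. (norm (?u t \<omega>))\<^sup>2 \<partial>M))"
  proof (rule summable_comparison_test')
    show "summable (\<lambda>t. 2 * (\<gamma> ^ t * (\<integral>\<omega>. (norm (?v t \<omega>))\<^sup>2 \<partial>M)) + 2 * (\<gamma> ^ t * (\<integral>\<omega>. (norm (cs.ubar t \<omega>))\<^sup>2 \<partial>M)))"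
      by (intro summable_add summable_mult v_sum ubar_sum)
    fix t
    have "(\<integral>\<omega>. (norm (?u t \<omega>))\<^sup>2 \<partial>M) \<le> (\<integral>\<omega>. 2 * (norm (?v t \<omega>))\<^sup>2 + 2 * (norm (cs.ubar t \<omega>))\<^sup>2 \<partial>M)"
    proof (rule integral_mono)
      show "(norm (?u t \<omega>))\<^sup>2 \<le> 2 * (norm (?v t \<omega>))\<^sup>2 + 2 * (norm (cs.ubar t \<omega>))\<^sup>2" for \<omega>
        using norm_add_squared_le[of 1 "?v t \<omega>" "cs.ubar t \<omega>"] by simp
    qed (simp_all add: int)
    hence "(\<integral>\<omega>. (norm (?u t \<omega>))\<^sup>2 \<partial>M) \<le> 2 * (\<integral>\<omega>. (norm (?v t \<omega>))\<^sup>2 \<partial>M) + 2 * (\<integral>\<omega>. (norm (cs.ubar t \<omega>))\<^sup>2 \<partial>M)"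
      by (simp add: int)
    from mult_left_mono[OF this, of "\<gamma> ^ t"]
    show "norm (\<gamma> ^ t * (\<integral>\<omega>. (norm (?u t \<omega>))\<^sup>2 \<partial>M))
        \<le> 2 * (\<gamma> ^ t * (\<integral>\<omega>. (norm (?v t \<omega>))\<^sup>2 \<partial>M)) + 2 * (\<gamma> ^ t * (\<integral>\<omega>. (norm (cs.ubar t \<omega>))\<^sup>2 \<partial>M))"
      using discount by (simp add: algebra_simps)
  qed
  thus ?thesis unfolding admissible_iff[OF discount(1)] using cs.u_adapted cs.u_L2 by blast
qed

text \<open>By \<open>cost_decomposition\<close> every cost is at least \<open>least_cost\<close>,
  and the closed loop attains it, so the infimum is this finite number. A control reaches it iff its
  excess g is 0.\<close>

lemma optimal_iff_feedback:
  "optimal_control M \<gamma> A Abar B Bbar Q Qbar R Rbar eps eps0 u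
    \<longleftrightarrow> u \<in> admissible M \<gamma> eps eps0 \<and> feedback u"
proof -
  have lower: "ennreal least_cost \<le> J v" if v: "v \<in> admissible M \<gamma> eps eps0" for v
  proof -
    from cost_decomposition[OF v] obtain g where "0 \<le> g" "J v = ennreal (least_cost + g)" by blast
    thus ?thesis by (simp add: ennreal_leI)
  qed
  have eq_iff: "J v = ennreal least_cost \<longleftrightarrow> feedback v" if v: "v \<in> admissible M \<gamma> eps eps0" for v
  proof -
    from cost_decomposition[OF v] obtain g
      where g: "0 \<le> g" "J v = ennreal (least_cost + g)" "g = 0 \<longleftrightarrow> feedback v" by blast
    \<comment> \<open>\<open>ennreal\<close> is injective only on nonnegative reals, hence the sign
      of \<open>least_cost\<close> matters.\<close>
    show ?thesis using g least_cost_nonneg by (simp add: ennreal_inj)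
  qed
  have "(INF v \<in> admissible M \<gamma> eps eps0. J v) = ennreal least_cost"
  proof (rule antisym)
    show "(INF v \<in> admissible M \<gamma> eps eps0. J v) \<le> ennreal least_cost"
      using eq_iff[OF closed_loop_admissible] feedback_closed_loop
      by (intro INF_lower2[OF closed_loop_admissible]) simp
  qed (intro INF_greatest lower)
  thus ?thesis unfolding optimal_control_def using eq_iff by auto
qed

text \<open>Each control obeys the law along its own state, so the states are compared by induction
  on time: almost surely equal states have almost surely equal conditional means, hence equal
  controls, hence equal next states.\<close>

lemma feedback_unique:
  assumes u: "u \<in> admissible M \<gamma> eps eps0" "feedback u"
    and v: "v \<in> admissible M \<gamma> eps eps0" "feedback v"
  shows "AE \<omega> in M. v t \<omega> = u t \<omega>"
proof -
  interpret U: controlled_state M eps eps0 A Abar B Bbar u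
    using u unfolding admissible_iff[OF discount(1)] by unfold_locales auto
  interpret V: controlled_state M eps eps0 A Abar B Bbar v
    using v unfolding admissible_iff[OF discount(1)] by unfold_locales auto
  have control: "AE \<omega> in M. v t \<omega> = u t \<omega>" if "AE \<omega> in M. V.X t \<omega> = U.X t \<omega>" for t
    using u(2)[unfolded feedback_def, rule_format, of t] v(2)[unfolded feedback_def, rule_format, of t]
      that cond_mean_cong[where f=V.X and g=U.X, OF that V.X(2) U.X(2)]
    by eventually_elim simp
  have "AE \<omega> in M. V.X t \<omega> = U.X t \<omega>" for t
  proof (induction t)
    case (Suc t)
    show ?case
      using Suc cond_mean_cong[where f=V.X and g=U.X, OF Suc V.X(2) U.X(2)]
        control[OF Suc] cond_mean_cong[where f=v and g=u, OF control[OF Suc] V.u_L2 U.u_L2]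
      by eventually_elim (simp add: cond_mean_def)
  qed simp
  thus ?thesis by (rule control)
qed

end

theorem theorem8:
  fixes M :: "'a measure"
    and \<gamma> :: real
    and A Abar Q Qbar :: "real ^ 'd ^ 'd"
    and B Bbar :: "real ^ 'l ^ 'd"
    and R Rbar :: "real ^ 'l ^ 'l"
    and eps eps0 :: "nat \<Rightarrow> 'a \<Rightarrow> real ^ 'd"
  assumes "prob_space M"
    and "0 < \<gamma>" and "\<gamma> < 1"
    and "\<And>t. subgaussian_vec M (eps t)"
    and "\<And>t. subgaussian_vec M (eps0 t)"
    and "prob_space.indep_vars M (\<lambda>_. borel) (case_sum eps eps0) (UNIV :: (nat + nat) set)"
    and "\<And>t. distr M borel (eps (Suc t)) = distr M borel (eps (Suc 0))"
    and "\<And>t. distr M borel (eps0 (Suc t)) = distr M borel (eps0 (Suc 0))"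
    and "\<And>t. (\<integral>\<omega>. eps (Suc t) \<omega> \<partial>M) = 0"
    and "\<And>t. (\<integral>\<omega>. eps0 (Suc t) \<omega> \<partial>M) = 0"
    and "\<gamma> * (spectral_norm A)\<^sup>2 < 1"
    and "\<gamma> * (spectral_norm (A + Abar))\<^sup>2 < 1"
    and "symmetric_mat Q" and "symmetric_mat Qbar"
    and "symmetric_mat R" and "symmetric_mat Rbar"
    and "pos_semidef Q" and "pos_semidef (Q + Qbar)"
    and "pos_def R" and "pos_def (R + Rbar)"
  shows "(\<exists>u. optimal_control M \<gamma> A Abar B Bbar Q Qbar R Rbar eps eps0 u \<and>
            (\<forall>v. optimal_control M \<gamma> A Abar B Bbar Q Qbar R Rbar eps eps0 v \<longrightarrow>
                 (\<forall>t. AE \<omega> in M. v t \<omega> = u t \<omega>))) \<and>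
         (\<exists>P Pbar.
            riccati \<gamma> A B Q R P \<and>
            riccati \<gamma> (A + Abar) (B + Bbar) (Q + Qbar) (R + Rbar) Pbar \<and>
            (\<forall>u. optimal_control M \<gamma> A Abar B Bbar Q Qbar R Rbar eps eps0 u \<longrightarrow>
              (let X = state M A Abar B Bbar eps eps0 u;
                   Xbar = cond_mean M eps0 X;
                   K = - (gain B R ** P);
                   L = - (gain (B + Bbar) (R + Rbar) ** Pbar)
               in \<forall>t. AE \<omega> in M. u t \<omega> = - (K *v (X t \<omega> - Xbar t \<omega>)) - L *v Xbar t \<omega>)))"
proof -
  interpret prob_space M by (rule assms(1))
  have Qt: "symmetric_mat (Q + Qbar)" and Rt: "symmetric_mat (R + Rbar)"
    using assms(13-16) by (auto intro: symmetric_mat_add)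
  obtain S where S: "symmetric_mat S" "pos_semidef S" "riccati_step \<gamma> A B Q R S = S"
    using riccati_fixed_point[OF assms(2,11,13,17,15,19)] by blast
  obtain Sbar where Sbar: "symmetric_mat Sbar" "pos_semidef Sbar"
    "riccati_step \<gamma> (A + Abar) (B + Bbar) (Q + Qbar) (R + Rbar) Sbar = Sbar"
    using riccati_fixed_point[OF assms(2,12) Qt assms(18) Rt assms(20)] by blast
  define K where "K = feedback_gain \<gamma> A B R S"
  define L where "L = feedback_gain \<gamma> (A + Abar) (B + Bbar) (R + Rbar) Sbar"
  have \<gamma>: "0 \<le> \<gamma>" using assms(2) by simp
  have K: "stationary_gain \<gamma> A B R S K"
    unfolding K_def by (rule stationary_feedback_gain[OF assms(19) S(2) \<gamma>])
  have L: "stationary_gain \<gamma> (A + Abar) (B + Bbar) (R + Rbar) Sbar L"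
    unfolding L_def by (rule stationary_feedback_gain[OF assms(20) Sbar(2) \<gamma>])
  \<comment> \<open>With the gain folded, the fixed-point equation is literally the Joseph equation
    required of the value matrix.\<close>
  note S_eq = S(3)[symmetric, unfolded riccati_step_def Let_def, folded K_def]
  note Sbar_eq = Sbar(3)[symmetric, unfolded riccati_step_def Let_def, folded L_def]
  interpret common_noise M eps eps0
    by unfold_locales (intro subgaussian_vec_imp_square_integrable assms | rule assms)+
  interpret mean_field_lq M eps eps0 \<gamma> A Abar Q Qbar S Sbar B Bbar R Rbar K L
    by unfold_locales (rule assms Rt S(1,2) Sbar(1,2) K L S_eq Sbar_eq)+
  \<comment> \<open>P x is the discounted gradient of the value form \<open>quad S\<close>, which is
    2 S z at z, taken at the noise-free next state z = (A - B K) x.\<close>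
  define P where "P = (2 * \<gamma>) *\<^sub>R (S ** (A - B ** K))"
  define Pbar where "Pbar = (2 * \<gamma>) *\<^sub>R (Sbar ** (A + Abar - (B + Bbar) ** L))"
  note P = riccati_solution[OF assms(15,19) S(1) K S_eq P_def]
  note Pbar = riccati_solution[OF Rt assms(20) Sbar(1) L Sbar_eq Pbar_def]
  have "optimal_control M \<gamma> A Abar B Bbar Q Qbar R Rbar eps eps0 closed_loop_control"
    by (simp add: optimal_iff_feedback closed_loop_admissible feedback_closed_loop)
  moreover have "\<forall>t. AE \<omega> in M. v t \<omega> = closed_loop_control t \<omega>"
    if "optimal_control M \<gamma> A Abar B Bbar Q Qbar R Rbar eps eps0 v" for v
    using that by (intro allI feedback_unique closed_loop_admissible feedback_closed_loop)
      (simp_all add: optimal_iff_feedback)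
  moreover have "let X = state M A Abar B Bbar eps eps0 u;
              Xbar = cond_mean M eps0 X;
              K = - (gain B R ** P);
              L = - (gain (B + Bbar) (R + Rbar) ** Pbar)
          in \<forall>t. AE \<omega> in M. u t \<omega> = - (K *v (X t \<omega> - Xbar t \<omega>)) - L *v Xbar t \<omega>"
    if "optimal_control M \<gamma> A Abar B Bbar Q Qbar R Rbar eps eps0 u" for u
    \<comment> \<open>The gains of the statement equal \<open>K\<close> and \<open>L\<close>, so the
      claim is the feedback law for \<open>u\<close>.\<close>
    using that unfolding Let_def P(2) Pbar(2) optimal_iff_feedback feedback_def by blast
  ultimately show ?thesis using P(1) Pbar(1) by blast
qed

end
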